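(* Suppose that the following two conditions hold at each $t\in\mathcal T$: (i) (convexity) Both $\mathcal S$ and $\mathcal A$ are convex real number spaces (convex subsets of $\mathbb R$), $\mathcal A$ is compact, and the feasible space of state-action pairs $\mathcal K$ is a convex set; (ii) (linearity) Both the state transition function $s_{t+1}=f_t(s_t,a_t,\xi_t)$ and the reward function $r_t(s_t,a_t,\xi_t)$ are linear in the state $s_t\in\mathcal S$ and the action $a_t\in\mathcal A$, that is, $$f_t(s_t,a_t,\xi_t)=f_{t,1}(\xi_t)s_t+f_{t,2}(\xi_t)a_t+f_{t,3}(\xi_t),\qquad r_t(s_t,a_t,\xi_t)=r_{t,1}(\xi_t)s_t+r_{t,2}(\xi_t)a_t+r_{t,3}(\xi_t),$$ where $\xi_t$ is a random variable capturing all the stochasticity of the system, with support on $\mathcal X$ and distribution $q_t$, and $f_{t,i},r_{t,i}$, $i=1,2,3$, are functions on $\mathcal X$. Then the iterative algorithm (Algorithm 1, described in the context) converges to the global optimum of the finite-horizon mean-variance MDP; that is, the mean-variance values $J_0^{u^{(k)}}(s_0)$ of the policies it generates converge to $J_0^*(s_0)$, and any policy $u^*$ at which it stops satisfies $J_0^{u^*}(s_0)=J_0^*(s_0)$.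
   Context: Setting. $\mathcal T=\{0,\ldots,T-1\}$, $T<\infty$. State space $\mathcal S$, action space $\mathcal A$, admissible actions $\mathcal A(s)\subset\mathcal A$, $\mathcal K=\{(s,a):s\in\mathcal S,a\in\mathcal A(s)\}$. At time $t$, in state $s_t$ with action $a_t\in\mathcal A(s_t)$, an independent random variable $\xi_t\sim q_t$ on $\mathcal X$ is realized, the reward is $r_t(s_t,a_t,\xi_t)$ and the next state is $s_{t+1}=f_t(s_t,a_t,\xi_t)\in\mathcal S$. $\mathcal U^{\rm HR}$ and $\mathcal U^{\rm HD}$ are the history-dependent randomized and deterministic (measurable) policies; the history at time $t$ includes past states, actions and realized rewards and the current state. $R_{0:T}$ is the sum of the rewards at times $0,\ldots,T-1$; $\mu_0^u(s_0)=\mathbb E_{s_0}^u[R_{0:T}]$, $\sigma_0^u(s_0)=\mathbb E_{s_0}^u[(R_{0:T}-\mu_0^u(s_0))^2]$; $\lambda\ge0$ is fixed. $J_0^u(s_0)=\mu_0^u(s_0)-\lambda\sigma_0^u(s_0)$, $J_0^*(s_0)=\sup_{u\in\mathcal U^{\rm HR}}J_0^u(s_0)$ (the finite-horizon mean-variance MDP). $\hat J_0^u(s_0,y_0)=\mathbb E_{s_0}^u[R_{0:T}-\lambda(R_{0:T}-y_0)^2]$, $\hat J_0^*(s_0,y_0)=\sup_{u\in\mathcal U^{\rm HR}}\hat J_0^u(s_0,y_0)$; the pseudo mean-variance MDP $\hat{\mathcal M}(y_0)$ is the latter maximization, and $u$ is optimal for it (for given $s_0$) if it attains $\hat J_0^*(s_0,y_0)$.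 $\mathcal Y\subset\mathbb R$ is an interval containing all means $\mu_0^u(s_0)$. Dynamic programming. $V_T^*(s,y)=-\lambda y^2$ and, for $t=T-1,\ldots,0$, $$V_t^*(s,y)=\max_{a\in\mathcal A(s)}\int_{\mathcal X}\{r_t(s,a,x)+V_{t+1}^*(f_t(s,a,x),y-r_t(s,a,x))\}\,q_t(dx).$$ Standing assumption for continuous spaces: all expectations are finite and the measurable selection condition holds, i.e. these maxima are attained by measurable functions $\tilde u_t^*(s,y)\in\mathcal A(s)$. Such $\tilde u^*=(\tilde u_t^* )$ is called an inner optimal policy; given $y_0$ it generates $u'\in\mathcal U^{\rm HD}$, choosing at time $t$ the action $\tilde u_t^*(s_t,\,y_0-\text{(sum of the rewards received at times }0,\ldots,t-1))$. Break point (for given $s_0$): $y^c\in\mathcal Y$ such that there exist $y_1<y^c<y_2$ for which the problems $\hat{\mathcal M}(y)$, $y\in[y_1,y^c]$, have the same optimal policy, while this policy is not optimal for $\hat{\mathcal M}(y)$, $y\in(y^c,y_2]$. Algorithm 1 (for initial state $s_0$). 1. Choose any $u^{(0)}\in\mathcal U^{\rm HD}$, $k\leftarrow0$. 2. Until $u^{(k)}=u^{(k-1)}$, repeat: (Policy evaluation) $y_0^{(k)}=\mathbb E_{s_0}^{u^{(k)}}[R_{0:T}]$. (Policy improvement) Solve $\hat{\mathcal M}(y_0^{(k)})$ by the dynamic programming above, obtain an inner optimal policy $\tilde u^*$ and generate from it, with $y_0=y_0^{(k)}$, the policy $u'$; keep $u'=u^{(k)}$ if possible. (Update) $u^{(k+1)}\leftarrow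 u'$, $k\leftarrow k+1$. 3. When the loop ends, if the current pseudo mean $y_0^{(k)}$ is a break point, return to the policy improvement step and choose another inner optimal policy $\tilde u^{*'}\neq\tilde u^*$ whose generated policy $u''$ satisfies $\hat J_0^{u''}(s_0,\mu_0^{u''}(s_0))>\hat J_0^{u'}(s_0,\mu_0^{u'}(s_0))$; set $u^{(k+1)}\leftarrow u''$, $k\leftarrow k+1$, and return to the policy evaluation step of item 2. 4. Otherwise stop and return $u^*=u^{(k)}$. *)

theory Defs
  imports "HOL-Probability.Probability"
begin

text \<open>
  A finite-horizon mean-variance MDP with real states and actions. Transition and reward are total
  functions, but only their values on admissible pairs and on points of the noise space matter.
\<close>

record 'x mv_mdp =
  horizon :: nat
  states :: "real set"
  actions :: "real set"
  admissible :: "real \<Rightarrow> real set"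
  noise_space :: "'x measure"
  noise_law :: "nat \<Rightarrow> 'x measure"
  transition :: "nat \<Rightarrow> real \<Rightarrow> real \<Rightarrow> 'x \<Rightarrow> real"
  reward :: "nat \<Rightarrow> real \<Rightarrow> real \<Rightarrow> 'x \<Rightarrow> real"
  risk_aversion :: real

definition state_actions :: "'x mv_mdp \<Rightarrow> (real \<times> real) set" where
  "state_actions M = {(s, a). s \<in> states M \<and> a \<in> admissible M s}"

definition mv_mdp :: "'x mv_mdp \<Rightarrow> bool" where
  "mv_mdp M \<longleftrightarrow>
     0 \<le> risk_aversion M \<and>
     (\<forall>s\<in>states M. admissible M s \<subseteq> actions M) \<and>
     (\<forall>t<horizon M.
        prob_space (noise_law M t) \<and>
        sets (noise_law M t) = sets (noise_space M) \<and>
        (\<lambda>(s, a, x). transition M t s a x)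
          \<in> borel_measurable (borel \<Otimes>\<^sub>M borel \<Otimes>\<^sub>M noise_space M) \<and>
        (\<lambda>(s, a, x). reward M t s a x)
          \<in> borel_measurable (borel \<Otimes>\<^sub>M borel \<Otimes>\<^sub>M noise_space M) \<and>
        (\<forall>(s, a)\<in>state_actions M. \<forall>x\<in>space (noise_space M). transition M t s a x \<in> states M))"

subsection \<open>Histories, policies and the induced law\<close>

text \<open>
  A history at time \<open>t\<close> consists of the states \<open>0, \<dots>, t\<close>, the actions \<open>0, \<dots>, t - 1\<close> and the
  realized rewards \<open>0, \<dots>, t - 1\<close>.
\<close>

type_synonym hist = "(nat \<Rightarrow> real) \<times> (nat \<Rightarrow> real) \<times> (nat \<Rightarrow> real)"

definition hist_space :: "nat \<Rightarrow> hist measure" where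
  "hist_space t =
     (\<Pi>\<^sub>M i\<in>{..t}. borel) \<Otimes>\<^sub>M (\<Pi>\<^sub>M i\<in>{..<t}. borel) \<Otimes>\<^sub>M (\<Pi>\<^sub>M i\<in>{..<t}. borel)"

definition histories :: "'x mv_mdp \<Rightarrow> nat \<Rightarrow> hist set" where
  "histories M t = {(ss, as, rs). (ss, as, rs) \<in> space (hist_space t) \<and>
     (\<forall>i\<le>t. ss i \<in> states M) \<and> (\<forall>i<t. (ss i, as i) \<in> state_actions M)}"

definition cur_state :: "nat \<Rightarrow> hist \<Rightarrow> real" where
  "cur_state t h = fst h t"

definition total_reward :: "nat \<Rightarrow> hist \<Rightarrow> real" where
  "total_reward t h = (\<Sum>i<t. snd (snd h) i)"

definition init_hist :: "real \<Rightarrow> hist" where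
  "init_hist s0 = ((\<lambda>_. undefined)(0 := s0), \<lambda>_. undefined, \<lambda>_. undefined)"

fun extend_hist :: "'x mv_mdp \<Rightarrow> nat \<Rightarrow> hist \<Rightarrow> real \<Rightarrow> 'x \<Rightarrow> hist" where
  "extend_hist M t (ss, as, rs) a x =
     (ss(Suc t := transition M t (ss t) a x), as(t := a), rs(t := reward M t (ss t) a x))"

text \<open>
  Policies are measurable on the ambient Euclidean history space and constrained on the genuine
  histories only; their values elsewhere are irrelevant. A measurable policy on the genuine
  histories always has such an extension, since its values lie in a standard Borel space.
\<close>

type_synonym rand_policy = "nat \<Rightarrow> hist \<Rightarrow> real measure"
type_synonym det_policy = "nat \<Rightarrow> hist \<Rightarrow> real"

definition policies_HR :: "'x mv_mdp \<Rightarrow> rand_policy set" where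
  "policies_HR M = {u. \<forall>t<horizon M.
     u t \<in> hist_space t \<rightarrow>\<^sub>M prob_algebra borel \<and>
     (\<forall>h\<in>histories M t. AE a in u t h. a \<in> admissible M (cur_state t h))}"

definition policies_HD :: "'x mv_mdp \<Rightarrow> det_policy set" where
  "policies_HD M = {u. \<forall>t<horizon M.
     u t \<in> borel_measurable (hist_space t) \<and>
     (\<forall>h\<in>histories M t. u t h \<in> admissible M (cur_state t h))}"

definition randomize :: "det_policy \<Rightarrow> rand_policy" where
  "randomize u = (\<lambda>t h. return borel (u t h))"

definition same_policy :: "'x mv_mdp \<Rightarrow> det_policy \<Rightarrow> det_policy \<Rightarrow> bool" where
  "same_policy M u v \<longleftrightarrow> (\<forall>t<horizon M. \<forall>h\<in>histories M t. u t h = v t h)"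

primrec hist_law :: "'x mv_mdp \<Rightarrow> real \<Rightarrow> rand_policy \<Rightarrow> nat \<Rightarrow> hist measure" where
  "hist_law M s0 u 0 = return (hist_space 0) (init_hist s0)"
| "hist_law M s0 u (Suc t) = hist_law M s0 u t \<bind> (\<lambda>h.
     distr (u t h \<Otimes>\<^sub>M noise_law M t) (hist_space (Suc t)) (\<lambda>(a, x). extend_hist M t h a x))"

definition expect :: "'x mv_mdp \<Rightarrow> real \<Rightarrow> rand_policy \<Rightarrow> (real \<Rightarrow> real) \<Rightarrow> real" where
  "expect M s0 u g = (\<integral>h. g (total_reward (horizon M) h) \<partial>hist_law M s0 u (horizon M))"

subsection \<open>Mean-variance and pseudo mean-variance criteria\<close>

definition mean :: "'x mv_mdp \<Rightarrow> real \<Rightarrow> rand_policy \<Rightarrow> real" where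
  "mean M s0 u = expect M s0 u (\<lambda>R. R)"

definition var :: "'x mv_mdp \<Rightarrow> real \<Rightarrow> rand_policy \<Rightarrow> real" where
  "var M s0 u = expect M s0 u (\<lambda>R. (R - mean M s0 u)\<^sup>2)"

definition J :: "'x mv_mdp \<Rightarrow> real \<Rightarrow> rand_policy \<Rightarrow> real" where
  "J M s0 u = mean M s0 u - risk_aversion M * var M s0 u"

definition J_opt :: "'x mv_mdp \<Rightarrow> real \<Rightarrow> ereal" where
  "J_opt M s0 = (SUP u\<in>policies_HR M. ereal (J M s0 u))"

definition Jhat :: "'x mv_mdp \<Rightarrow> real \<Rightarrow> real \<Rightarrow> rand_policy \<Rightarrow> real" where
  "Jhat M s0 y u = expect M s0 u (\<lambda>R. R - risk_aversion M * (R - y)\<^sup>2)"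

definition Jhat_opt :: "'x mv_mdp \<Rightarrow> real \<Rightarrow> real \<Rightarrow> ereal" where
  "Jhat_opt M s0 y = (SUP u\<in>policies_HR M. ereal (Jhat M s0 y u))"

definition pseudo_optimal :: "'x mv_mdp \<Rightarrow> real \<Rightarrow> real \<Rightarrow> rand_policy \<Rightarrow> bool" where
  "pseudo_optimal M s0 y u \<longleftrightarrow>
     u \<in> policies_HR M \<and> ereal (Jhat M s0 y u) = Jhat_opt M s0 y"

definition break_point :: "'x mv_mdp \<Rightarrow> real set \<Rightarrow> real \<Rightarrow> real \<Rightarrow> bool" where
  "break_point M Y s0 yc \<longleftrightarrow> yc \<in> Y \<and>
     (\<exists>y1 y2. y1 < yc \<and> yc < y2 \<and>
        (\<exists>u. (\<forall>y\<in>{y1..yc}. pseudo_optimal M s0 y u) \<and>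
             (\<forall>y\<in>{yc<..y2}. \<not> pseudo_optimal M s0 y u)))"

subsection \<open>Dynamic programming\<close>

text \<open>
  \<open>value_rem M n\<close> is the value function with \<open>n\<close> stages to go. The supremum is the maximum of the
  dynamic programming equation as soon as an inner optimal policy exists.
\<close>

primrec value_rem :: "'x mv_mdp \<Rightarrow> nat \<Rightarrow> real \<Rightarrow> real \<Rightarrow> real" where
  "value_rem M 0 s y = - risk_aversion M * y\<^sup>2"
| "value_rem M (Suc n) s y =
     (let t = horizon M - Suc n in
      SUP a\<in>admissible M s.
        \<integral>x. reward M t s a x + value_rem M n (transition M t s a x) (y - reward M t s a x)
          \<partial>noise_law M t)"

definition value_fun :: "'x mv_mdp \<Rightarrow> nat \<Rightarrow> real \<Rightarrow> real \<Rightarrow> real" where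
  "value_fun M t = value_rem M (horizon M - t)"

definition stage_gain :: "'x mv_mdp \<Rightarrow> nat \<Rightarrow> real \<Rightarrow> real \<Rightarrow> real \<Rightarrow> 'x \<Rightarrow> real" where
  "stage_gain M t s y a x =
     reward M t s a x + value_fun M (Suc t) (transition M t s a x) (y - reward M t s a x)"

type_synonym inner_policy = "nat \<Rightarrow> real \<Rightarrow> real \<Rightarrow> real"

definition inner_optimal :: "'x mv_mdp \<Rightarrow> inner_policy \<Rightarrow> bool" where
  "inner_optimal M w \<longleftrightarrow> (\<forall>t<horizon M.
     (\<lambda>(s, y). w t s y) \<in> borel_measurable (borel \<Otimes>\<^sub>M borel) \<and>
     (\<forall>s\<in>states M. \<forall>y. w t s y \<in> admissible M s \<and>
        (\<forall>a\<in>admissible M s.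
           (\<integral>x. stage_gain M t s y a x \<partial>noise_law M t)
           \<le> (\<integral>x. stage_gain M t s y (w t s y) x \<partial>noise_law M t))))"

definition same_inner :: "'x mv_mdp \<Rightarrow> inner_policy \<Rightarrow> inner_policy \<Rightarrow> bool" where
  "same_inner M v w \<longleftrightarrow> (\<forall>t<horizon M. \<forall>s\<in>states M. \<forall>y. v t s y = w t s y)"

definition generated :: "inner_policy \<Rightarrow> real \<Rightarrow> det_policy" where
  "generated w y0 = (\<lambda>t h. w t (cur_state t h) (y0 - total_reward t h))"

definition finite_expectations :: "'x mv_mdp \<Rightarrow> bool" where
  "finite_expectations M \<longleftrightarrow>
     (\<forall>s\<in>states M. \<forall>u\<in>policies_HR M.
        integrable (hist_law M s u (horizon M)) (total_reward (horizon M)) \<and>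
        integrable (hist_law M s u (horizon M)) (\<lambda>h. (total_reward (horizon M) h)\<^sup>2)) \<and>
     (\<forall>t<horizon M. \<forall>(s, a)\<in>state_actions M. \<forall>y.
        integrable (noise_law M t) (stage_gain M t s y a))"

subsection \<open>The iterative algorithm\<close>

text \<open>
  A run is given by the policies \<open>u 0, u 1, \<dots>\<close> and the inner optimal policies \<open>w 0, w 1, \<dots>\<close>, where
  \<open>w k\<close> is the one from which \<open>u (Suc k)\<close> is generated.
\<close>

definition pseudo_mean :: "'x mv_mdp \<Rightarrow> real \<Rightarrow> det_policy \<Rightarrow> real" where
  "pseudo_mean M s0 u = mean M s0 (randomize u)"

definition improvement ::
    "'x mv_mdp \<Rightarrow> real \<Rightarrow> det_policy \<Rightarrow> inner_policy \<Rightarrow> det_policy \<Rightarrow> bool" where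
  "improvement M s0 u w u' \<longleftrightarrow>
     inner_optimal M w \<and> u' = generated w (pseudo_mean M s0 u) \<and>
     ((\<exists>v. inner_optimal M v \<and> same_policy M (generated v (pseudo_mean M s0 u)) u)
        \<longrightarrow> same_policy M u' u)"

text \<open>
  \<open>u\<close> is the policy with which the loop ended, \<open>v\<close> the inner optimal policy that generated it, and
  \<open>w\<close> the new inner optimal policy.
\<close>

definition restart ::
    "'x mv_mdp \<Rightarrow> real set \<Rightarrow> real \<Rightarrow> det_policy \<Rightarrow> inner_policy \<Rightarrow> inner_policy \<Rightarrow> det_policy \<Rightarrow> bool"
  where
  "restart M Y s0 u v w u'' \<longleftrightarrow>
     break_point M Y s0 (pseudo_mean M s0 u) \<and>
     inner_optimal M w \<and> \<not> same_inner M w v \<and> u'' = generated w (pseudo_mean M s0 u) \<and>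
     Jhat M s0 (pseudo_mean M s0 u'') (randomize u'') > Jhat M s0 (pseudo_mean M s0 u) (randomize u)"

definition loop_ended :: "'x mv_mdp \<Rightarrow> (nat \<Rightarrow> det_policy) \<Rightarrow> nat \<Rightarrow> bool" where
  "loop_ended M u k \<longleftrightarrow> 0 < k \<and> same_policy M (u k) (u (k - 1))"

definition alg_step ::
    "'x mv_mdp \<Rightarrow> real set \<Rightarrow> real \<Rightarrow> (nat \<Rightarrow> det_policy) \<Rightarrow> (nat \<Rightarrow> inner_policy) \<Rightarrow> nat \<Rightarrow> bool" where
  "alg_step M Y s0 u w k \<longleftrightarrow>
     (if loop_ended M u k then restart M Y s0 (u k) (w (k - 1)) (w k) (u (Suc k))
      else improvement M s0 (u k) (w k) (u (Suc k)))"

definition alg_run ::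
    "'x mv_mdp \<Rightarrow> real set \<Rightarrow> real \<Rightarrow> (nat \<Rightarrow> det_policy) \<Rightarrow> (nat \<Rightarrow> inner_policy) \<Rightarrow> nat \<Rightarrow> bool" where
  "alg_run M Y s0 u w n \<longleftrightarrow> u 0 \<in> policies_HD M \<and> (\<forall>k<n. alg_step M Y s0 u w k)"

text \<open>
  The algorithm stops also at a break point at which no strictly better policy is available, since
  it could not continue there.
\<close>

definition alg_stops ::
    "'x mv_mdp \<Rightarrow> real set \<Rightarrow> real \<Rightarrow> (nat \<Rightarrow> det_policy) \<Rightarrow> (nat \<Rightarrow> inner_policy) \<Rightarrow> nat \<Rightarrow> bool" where
  "alg_stops M Y s0 u w n \<longleftrightarrow>
     alg_run M Y s0 u w n \<and> loop_ended M u n \<and>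
     (\<nexists>v u''. restart M Y s0 (u n) (w (n - 1)) v u'')"

end

theory Submission
  imports Defs
begin

text \<open>
  Since \<open>var\<close> is the minimal mean squared deviation, \<open>J u\<close> is the maximum over \<open>y\<close> of the pseudo value
  \<open>Jhat y u = J u - \<lambda> (y - mean u)\<^sup>2\<close>. Hence \<open>J_opt\<close> is the supremum over \<open>y\<close> of the optimal pseudo value
  \<open>g(y)\<close>, which dynamic programming identifies with \<open>value_fun 0 s0 y\<close>. Convexity and linearity make \<open>g\<close>
  concave, because every backward step maximizes a jointly concave function over a section of a convex
  set. If \<open>u\<close> is optimal for the pseudo problem at \<open>y\<close>, the parabola \<open>Jhat \<cdot> u\<close> touches \<open>g\<close> from below at
  \<open>y\<close>, so \<open>g\<close> has slope \<open>2 \<lambda> (mean u - y)\<close> there, and moving from \<open>y\<close> to \<open>mean u\<close> is a gradient ascent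
  step for \<open>g\<close>. A fixed point is therefore a global maximum, and the usual telescoping
  argument bounds the gap after \<open>n\<close> steps by \<open>\<lambda> (z - y\<^sub>0)\<^sup>2 / n\<close> relative to \<open>g(z)\<close>. In particular break
  points play no role: a restart is one more ascent step.
\<close>

subsection \<open>Integration and history laws\<close>

text \<open>Fubini for a kernel with an integrand that may be unbounded, as the total reward may be.
  The version for nonnegative functions handles \<open>norm (f y)\<close>, which gives integrability
  under almost every \<open>K x\<close>, and then the positive and negative parts of
  \<open>f\<close>.\<close>

lemma
  fixes f :: "'b \<Rightarrow> real"
  assumes K[measurable]: "K \<in> M \<rightarrow>\<^sub>M subprob_algebra N"
    and ne: "space M \<noteq> {}"
    and f: "integrable (M \<bind> K) f"
  shows AE_integrable_bind_kernel: "AE x in M. integrable (K x) f"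
    and integrable_integral_kernel: "integrable M (\<lambda>x. \<integral>y. f y \<partial>K x)"
    and integral_bind_integrable: "(\<integral>z. f z \<partial>(M \<bind> K)) = (\<integral>x. (\<integral>y. f y \<partial>K x) \<partial>M)"
proof -
  have "sets (M \<bind> K) = sets N"
    by (rule sets_bind[OF sets_kernel[OF K] ne])
  then have f_meas[measurable]: "f \<in> borel_measurable N"
    using borel_measurable_integrable[OF f] measurable_cong_sets by blast
  have meas_K: "g \<in> borel_measurable (K x)" if "x \<in> space M" "g \<in> borel_measurable N"
    for x and g :: "'b \<Rightarrow> real"
    using sets_kernel[OF K that(1)] that(2) measurable_cong_sets by blast
  have int_meas[measurable]: "(\<lambda>x. \<integral>y. g y \<partial>K x) \<in> borel_measurable M"
    if [measurable]: "g \<in> borel_measurable N" for g :: "'b \<Rightarrow> real"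
    by measurable
  have nn_meas[measurable]: "(\<lambda>x. \<integral>\<^sup>+y. ennreal (g y) \<partial>K x) \<in> borel_measurable M"
    if [measurable]: "g \<in> borel_measurable N" for g :: "'b \<Rightarrow> real"
    by (rule measurable_compose[OF K nn_integral_measurable_subprob_algebra]) measurable
  have nn: "(\<integral>\<^sup>+z. ennreal (g z) \<partial>(M \<bind> K)) = (\<integral>\<^sup>+x. \<integral>\<^sup>+y. ennreal (g y) \<partial>K x \<partial>M)"
    if [measurable]: "g \<in> borel_measurable N" for g :: "'b \<Rightarrow> real"
    by (rule nn_integral_bind[OF _ K]) measurable
  have fin: "(\<integral>\<^sup>+x. \<integral>\<^sup>+y. ennreal (norm (f y)) \<partial>K x \<partial>M) < \<infinity>"
    using f nn[of "\<lambda>y. norm (f y)"] by (simp add: integrable_iff_bounded)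
  then have "AE x in M. (\<integral>\<^sup>+y. ennreal (norm (f y)) \<partial>K x) \<noteq> \<infinity>"
    by (intro nn_integral_PInf_AE) auto
  with AE_space show AE: "AE x in M. integrable (K x) f"
    by eventually_elim (auto simp: integrable_iff_bounded meas_K less_top)
  have "(\<integral>\<^sup>+x. ennreal (norm (\<integral>y. f y \<partial>K x)) \<partial>M)
      \<le> (\<integral>\<^sup>+x. \<integral>\<^sup>+y. ennreal (norm (f y)) \<partial>K x \<partial>M)"
    using AE by (intro nn_integral_mono_AE, eventually_elim) (rule integral_norm_bound_ennreal)
  with fin show int: "integrable M (\<lambda>x. \<integral>y. f y \<partial>K x)"
    by (subst integrable_iff_bounded) (auto intro: le_less_trans)
  \<comment> \<open>With \<open>c = 1\<close> and \<open>c = - 1\<close> this covers the positive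
    and the negative part of \<open>f\<close>.\<close>
  have part: "integrable M (\<lambda>x. \<integral>y. max 0 (c * f y) \<partial>K x) \<and>
      (\<integral>z. max 0 (c * f z) \<partial>(M \<bind> K)) = (\<integral>x. (\<integral>y. max 0 (c * f y) \<partial>K x) \<partial>M)" for c
  proof -
    let ?g = "\<lambda>y. max 0 (c * f y)"
    have g_int: "integrable (M \<bind> K) ?g"
      using f by (auto intro!: Bochner_Integration.integrable_max)
    have AE_nn: "AE x in M. (\<integral>\<^sup>+y. ennreal (?g y) \<partial>K x) = ennreal (\<integral>y. ?g y \<partial>K x)"
      using AE
      by eventually_elim (intro nn_integral_eq_integral Bochner_Integration.integrable_max, auto)
    have "ennreal (\<integral>z. ?g z \<partial>(M \<bind> K)) = (\<integral>\<^sup>+z. ennreal (?g z) \<partial>(M \<bind> K))"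
      using g_int by (intro nn_integral_eq_integral[symmetric]) auto
    also have "\<dots> = (\<integral>\<^sup>+x. \<integral>\<^sup>+y. ennreal (?g y) \<partial>K x \<partial>M)"
      by (rule nn) measurable
    also have "\<dots> = (\<integral>\<^sup>+x. ennreal (\<integral>y. ?g y \<partial>K x) \<partial>M)"
      using AE_nn by (rule nn_integral_cong_AE)
    finally have eq: "(\<integral>\<^sup>+x. ennreal (\<integral>y. ?g y \<partial>K x) \<partial>M) = ennreal (\<integral>z. ?g z \<partial>(M \<bind> K))"
      by simp
    have "integrable M (\<lambda>x. \<integral>y. ?g y \<partial>K x)"
      by (rule integrableI_nn_integral_finite[OF _ _ eq]) auto
    moreover have "(\<integral>x. (\<integral>y. ?g y \<partial>K x) \<partial>M) = (\<integral>z. ?g z \<partial>(M \<bind> K))"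
      by (subst integral_eq_nn_integral) (auto simp: eq)
    ultimately show ?thesis by simp
  qed
  have f_split: "f y = max 0 (1 * f y) - max 0 (- 1 * f y)" for y by auto
  have "(\<integral>z. f z \<partial>(M \<bind> K)) = (\<integral>z. max 0 (1 * f z) - max 0 (- 1 * f z) \<partial>(M \<bind> K))"
    using f_split by simp
  also have "\<dots> = (\<integral>z. max 0 (1 * f z) \<partial>(M \<bind> K)) - (\<integral>z. max 0 (- 1 * f z) \<partial>(M \<bind> K))"
    using f by (intro Bochner_Integration.integral_diff Bochner_Integration.integrable_max) auto
  also have "\<dots> = (\<integral>x. (\<integral>y. max 0 (1 * f y) \<partial>K x) - (\<integral>y. max 0 (- 1 * f y) \<partial>K x) \<partial>M)"
    using part[of 1] part[of "- 1"] by simp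
  also have "\<dots> = (\<integral>x. (\<integral>y. f y \<partial>K x) \<partial>M)"
  proof (rule integral_cong_AE)
    show "AE x in M. (\<integral>y. max 0 (1 * f y) \<partial>K x) - (\<integral>y. max 0 (- 1 * f y) \<partial>K x) = (\<integral>y. f y \<partial>K x)"
      using AE
    proof eventually_elim
      case (elim x)
      then have "(\<integral>y. max 0 (1 * f y) \<partial>K x) - (\<integral>y. max 0 (- 1 * f y) \<partial>K x)
          = (\<integral>y. max 0 (1 * f y) - max 0 (- 1 * f y) \<partial>K x)"
        by (intro Bochner_Integration.integral_diff[symmetric] Bochner_Integration.integrable_max) auto
      then show ?case using f_split by simp
    qed
  qed auto
  finally show "(\<integral>z. f z \<partial>(M \<bind> K)) = (\<integral>x. (\<integral>y. f y \<partial>K x) \<partial>M)" .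
qed

section \<open>Histories and their one-step kernels\<close>

lemma cur_state_measurable[measurable]: "cur_state t \<in> borel_measurable (hist_space t)"
  unfolding hist_space_def cur_state_def[abs_def] by measurable

lemma total_reward_measurable[measurable]: "total_reward t \<in> borel_measurable (hist_space t)"
  unfolding hist_space_def total_reward_def[abs_def] by measurable

definition hist_kernel :: "'x mv_mdp \<Rightarrow> rand_policy \<Rightarrow> nat \<Rightarrow> hist \<Rightarrow> hist measure" where
  "hist_kernel M u t h =
     distr (u t h \<Otimes>\<^sub>M noise_law M t) (hist_space (Suc t)) (\<lambda>(a, x). extend_hist M t h a x)"

lemma hist_law_Suc: "hist_law M s u (Suc t) = hist_law M s u t \<bind> hist_kernel M u t"
  by (simp add: hist_kernel_def[abs_def])

lemma cur_state_extend_hist: "cur_state (Suc t) (extend_hist M t h a x) = transition M t (cur_state t h) a x"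
  by (cases h) (simp add: cur_state_def)

lemma total_reward_extend_hist:
  "total_reward (Suc t) (extend_hist M t h a x) = total_reward t h + reward M t (cur_state t h) a x"
  by (cases h) (simp add: cur_state_def total_reward_def)

lemma init_hist_in_space: "init_hist s \<in> space (hist_space 0)"
  by (auto simp: init_hist_def hist_space_def space_pair_measure space_PiM PiE_def extensional_def)

lemma hist_law_cong:
  assumes "\<And>i. i < t \<Longrightarrow> u i = v i"
  shows "hist_law M s u t = hist_law M s v t"
  using assms by (induction t) auto

locale wf_mdp =
  fixes M :: "'x mv_mdp"
  assumes mdp: "mv_mdp M"
begin

lemma prob_space_noise: "t < horizon M \<Longrightarrow> prob_space (noise_law M t)"
  and sets_noise: "t < horizon M \<Longrightarrow> sets (noise_law M t) = sets (noise_space M)"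
  and transition_measurable: "t < horizon M \<Longrightarrow> (\<lambda>(s, a, x). transition M t s a x)
          \<in> borel_measurable (borel \<Otimes>\<^sub>M borel \<Otimes>\<^sub>M noise_space M)"
  and reward_measurable: "t < horizon M \<Longrightarrow> (\<lambda>(s, a, x). reward M t s a x)
          \<in> borel_measurable (borel \<Otimes>\<^sub>M borel \<Otimes>\<^sub>M noise_space M)"
  and transition_in_states: "t < horizon M \<Longrightarrow> s \<in> states M \<Longrightarrow> a \<in> admissible M s \<Longrightarrow>
    x \<in> space (noise_space M) \<Longrightarrow> transition M t s a x \<in> states M"
  using mdp by (auto simp: mv_mdp_def state_actions_def)

lemma space_noise: "t < horizon M \<Longrightarrow> space (noise_law M t) = space (noise_space M)"
  using sets_noise sets_eq_imp_space_eq by blast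

lemma transition_comp_measurable:
  assumes "t < horizon M" "f \<in> borel_measurable N" "g \<in> borel_measurable N" "k \<in> N \<rightarrow>\<^sub>M noise_space M"
  shows "(\<lambda>z. transition M t (f z) (g z) (k z)) \<in> borel_measurable N"
  using measurable_compose[OF measurable_Pair[OF assms(2) measurable_Pair[OF assms(3,4)]]
      transition_measurable[OF assms(1)]] by simp

lemma reward_comp_measurable:
  assumes "t < horizon M" "f \<in> borel_measurable N" "g \<in> borel_measurable N" "k \<in> N \<rightarrow>\<^sub>M noise_space M"
  shows "(\<lambda>z. reward M t (f z) (g z) (k z)) \<in> borel_measurable N"
  using measurable_compose[OF measurable_Pair[OF assms(2) measurable_Pair[OF assms(3,4)]]
      reward_measurable[OF assms(1)]] by simp

lemma extend_hist_measurable: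
  assumes t: "t < horizon M"
  shows "(\<lambda>(h, a, x). extend_hist M t h a x)
    \<in> hist_space t \<Otimes>\<^sub>M borel \<Otimes>\<^sub>M noise_space M \<rightarrow>\<^sub>M hist_space (Suc t)"
proof -
  let ?N = "hist_space t \<Otimes>\<^sub>M borel \<Otimes>\<^sub>M noise_space M"
  have cs: "(\<lambda>z. cur_state t (fst z)) \<in> borel_measurable ?N" by measurable
  have k: "(\<lambda>z. snd (snd z)) \<in> ?N \<rightarrow>\<^sub>M noise_space M" by measurable
  have a: "(\<lambda>z. fst (snd z)) \<in> borel_measurable ?N" by measurable
  note tr = transition_comp_measurable[OF t cs a k] and rw = reward_comp_measurable[OF t cs a k]
  have comps:
    "(\<lambda>z. fst (fst z)) \<in> ?N \<rightarrow>\<^sub>M (\<Pi>\<^sub>M i\<in>{..t}. borel)"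
    "(\<lambda>z. fst (snd (fst z))) \<in> ?N \<rightarrow>\<^sub>M (\<Pi>\<^sub>M i\<in>{..<t}. borel)"
    "(\<lambda>z. snd (snd (fst z))) \<in> ?N \<rightarrow>\<^sub>M (\<Pi>\<^sub>M i\<in>{..<t}. borel)"
    unfolding hist_space_def by measurable
  \<comment> \<open>In projection form the three components are single-point updates of product
    points, so each index set grows by one element.\<close>
  have "(\<lambda>z. ((fst (fst z))(Suc t := transition M t (cur_state t (fst z)) (fst (snd z)) (snd (snd z))),
      (fst (snd (fst z)))(t := fst (snd z)),
      (snd (snd (fst z)))(t := reward M t (cur_state t (fst z)) (fst (snd z)) (snd (snd z)))))
    \<in> ?N \<rightarrow>\<^sub>M hist_space (Suc t)"
    unfolding hist_space_def[of "Suc t"]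
    by (intro measurable_Pair measurable_fun_upd[where J="{..t}"] measurable_fun_upd[where J="{..<t}"]
        tr rw a comps) auto
  then show ?thesis
    by (rule measurable_cong[THEN iffD1, rotated]) (auto simp: cur_state_def)
qed

text \<open>The noise is drawn independently of the action, so the kernel is the image of the
  product of \<open>u t\<close> with a constant kernel under a jointly measurable map.\<close>

lemma hist_kernel_measurable:
  assumes t: "t < horizon M" and u: "u \<in> policies_HR M"
  shows "hist_kernel M u t \<in> hist_space t \<rightarrow>\<^sub>M prob_algebra (hist_space (Suc t))"
proof -
  interpret prob_space "noise_law M t" by (rule prob_space_noise[OF t])
  have u': "u t \<in> hist_space t \<rightarrow>\<^sub>M prob_algebra borel"
    using u t by (simp add: policies_HR_def)
  have "noise_law M t \<in> space (prob_algebra (noise_space M))"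
    using sets_noise[OF t] prob_space_axioms by (simp add: space_prob_algebra)
  then have n: "(\<lambda>_. noise_law M t) \<in> hist_space t \<rightarrow>\<^sub>M prob_algebra (noise_space M)" by simp
  have "(\<lambda>h. u t h \<Otimes>\<^sub>M noise_law M t) \<in> hist_space t \<rightarrow>\<^sub>M prob_algebra (borel \<Otimes>\<^sub>M noise_space M)"
    by (rule measurable_pair_prob[OF u' n])
  then show ?thesis
    unfolding hist_kernel_def[abs_def]
    by (rule measurable_distr_prob_space2) (use extend_hist_measurable[OF t] in \<open>simp add: case_prod_unfold\<close>)
qed

lemma hist_law_in_prob_algebra:
  assumes u: "u \<in> policies_HR M"
  shows "t \<le> horizon M \<Longrightarrow> hist_law M s u t \<in> space (prob_algebra (hist_space t))"
proof (induction t)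
  case 0
  show ?case using init_hist_in_space by (auto simp: space_prob_algebra intro!: prob_space_return)
next
  case (Suc t)
  then have "hist_law M s u t \<in> space (prob_algebra (hist_space t))" "t < horizon M" by auto
  then show ?case
    unfolding hist_law_Suc using hist_kernel_measurable[OF _ u, of t]
    by (auto simp: space_prob_algebra[of "hist_space (Suc t)"] intro!: prob_space_bind' sets_bind')
qed

lemma extend_hist_in_histories:
  assumes "t < horizon M" "h \<in> histories M t" "a \<in> admissible M (cur_state t h)"
    "x \<in> space (noise_space M)"
  shows "extend_hist M t h a x \<in> histories M (Suc t)"
proof -
  have "extend_hist M t h a x \<in> space (hist_space (Suc t))"
    using measurable_space[OF extend_hist_measurable[OF assms(1)], of "(h, a, x)"] assms
    by (auto simp: histories_def space_pair_measure)
  then show ?thesis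
    using assms transition_in_states[OF assms(1) _ assms(3,4)]
    by (cases h) (auto simp: histories_def cur_state_def state_actions_def less_Suc_eq le_Suc_eq)
qed

lemma cur_state_in_states: "h \<in> histories M t \<Longrightarrow> cur_state t h \<in> states M"
  by (auto simp: histories_def cur_state_def)

lemma histories_subset_space: "h \<in> histories M t \<Longrightarrow> h \<in> space (hist_space t)"
  by (auto simp: histories_def)

lemma init_hist_in_histories: "s \<in> states M \<Longrightarrow> init_hist s \<in> histories M 0"
  using init_hist_in_space[of s] by (auto simp: init_hist_def histories_def)

end

lemma randomize_in_policies_HR:
  assumes "u \<in> policies_HD M"
  shows "randomize u \<in> policies_HR M"
  unfolding policies_HR_def
proof (intro CollectI allI impI conjI ballI)
  fix t assume t: "t < horizon M"
  then have u[measurable]: "u t \<in> borel_measurable (hist_space t)"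
    using assms by (simp add: policies_HD_def)
  show "randomize u t \<in> hist_space t \<rightarrow>\<^sub>M prob_algebra borel"
    unfolding randomize_def by measurable
  fix h assume "h \<in> histories M t"
  then have "u t h \<in> admissible M (cur_state t h)"
    using assms t by (simp add: policies_HD_def)
  moreover have "AE a in randomize u t h. a = u t h"
    unfolding randomize_def by (subst AE_return) auto
  ultimately show "AE a in randomize u t h. a \<in> admissible M (cur_state t h)"
    by (auto elim: eventually_mono)
qed

context wf_mdp
begin

lemma generated_in_policies_HD:
  assumes w: "inner_optimal M w"
  shows "generated w y \<in> policies_HD M"
  unfolding policies_HD_def
proof (intro CollectI allI impI conjI ballI)
  fix t assume t: "t < horizon M"
  then have "(\<lambda>(s, y). w t s y) \<in> borel_measurable (borel \<Otimes>\<^sub>M borel)"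
    using w by (simp add: inner_optimal_def)
  moreover have "(\<lambda>h. (cur_state t h, y - total_reward t h)) \<in> hist_space t \<rightarrow>\<^sub>M borel \<Otimes>\<^sub>M borel"
    by measurable
  ultimately have "(\<lambda>h. (\<lambda>(s, y). w t s y) (cur_state t h, y - total_reward t h))
      \<in> borel_measurable (hist_space t)"
    by (rule measurable_compose[rotated])
  then show "generated w y t \<in> borel_measurable (hist_space t)"
    by (simp add: generated_def)
  fix h assume "h \<in> histories M t"
  then show "generated w y t h \<in> admissible M (cur_state t h)"
    using w t cur_state_in_states by (auto simp: generated_def inner_optimal_def)
qed

lemma
  assumes t: "t < horizon M" and u: "u \<in> policies_HR M" and h: "h \<in> space (hist_space t)"
  shows prob_space_policy: "prob_space (u t h)" and sets_policy: "sets (u t h) = sets borel"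
proof -
  have "u t \<in> hist_space t \<rightarrow>\<^sub>M prob_algebra borel"
    using u t by (simp add: policies_HR_def)
  from measurable_space[OF this h] show "prob_space (u t h)" "sets (u t h) = sets borel"
    by (simp_all add: space_prob_algebra)
qed

lemma extend_hist_section_measurable:
  assumes t: "t < horizon M" and u: "u \<in> policies_HR M" and h: "h \<in> space (hist_space t)"
  shows "(\<lambda>(a, x). extend_hist M t h a x) \<in> u t h \<Otimes>\<^sub>M noise_law M t \<rightarrow>\<^sub>M hist_space (Suc t)"
proof -
  have s: "sets (u t h \<Otimes>\<^sub>M noise_law M t) = sets (borel \<Otimes>\<^sub>M noise_space M)"
    by (rule sets_pair_measure_cong[OF sets_policy[OF assms] sets_noise[OF t]])
  have "(\<lambda>z. (h, z)) \<in> borel \<Otimes>\<^sub>M noise_space M \<rightarrow>\<^sub>M hist_space t \<Otimes>\<^sub>M borel \<Otimes>\<^sub>M noise_space M"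
    using h by (rule measurable_Pair1')
  from measurable_compose[OF this extend_hist_measurable[OF t]]
  show ?thesis by (simp add: measurable_cong_sets[OF s refl])
qed

lemma
  fixes F :: "hist \<Rightarrow> real"
  assumes t: "t < horizon M" and u: "u \<in> policies_HR M" and h: "h \<in> space (hist_space t)"
    and F: "integrable (hist_kernel M u t h) F"
  shows integral_hist_kernel: "(\<integral>h'. F h' \<partial>hist_kernel M u t h)
      = (\<integral>a. (\<integral>x. F (extend_hist M t h a x) \<partial>noise_law M t) \<partial>u t h)"
    and integrable_hist_kernel: "integrable (u t h) (\<lambda>a. \<integral>x. F (extend_hist M t h a x) \<partial>noise_law M t)"
proof -
  interpret N: prob_space "noise_law M t" by (rule prob_space_noise[OF t])
  interpret U: prob_space "u t h" by (rule prob_space_policy[OF t u h])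
  interpret pair_prob_space "u t h" "noise_law M t" ..
  have [measurable]: "F \<in> borel_measurable (hist_space (Suc t))"
    using borel_measurable_integrable[OF F] by (simp add: hist_kernel_def)
  note [measurable] = extend_hist_section_measurable[OF t u h]
  have int: "integrable (u t h \<Otimes>\<^sub>M noise_law M t) (\<lambda>(a, x). F (extend_hist M t h a x))"
    using F unfolding hist_kernel_def
    by (subst (asm) integrable_distr_eq) (auto simp: case_prod_unfold)
  have "(\<integral>h'. F h' \<partial>hist_kernel M u t h)
      = (\<integral>(a, x). F (extend_hist M t h a x) \<partial>(u t h \<Otimes>\<^sub>M noise_law M t))"
    unfolding hist_kernel_def by (subst integral_distr) (auto simp: case_prod_unfold)
  also have "\<dots> = (\<integral>a. (\<integral>x. F (extend_hist M t h a x) \<partial>noise_law M t) \<partial>u t h)"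
    using integral_fst[OF int] by simp
  finally show "(\<integral>h'. F h' \<partial>hist_kernel M u t h)
      = (\<integral>a. (\<integral>x. F (extend_hist M t h a x) \<partial>noise_law M t) \<partial>u t h)" .
  show "integrable (u t h) (\<lambda>a. \<integral>x. F (extend_hist M t h a x) \<partial>noise_law M t)"
    using integrable_fst[OF int] by simp
qed

text \<open>
  The genuine histories need not form a measurable set (a convex set in the plane may fail to be Borel),
  so \<open>P\<close> is pulled back through the kernels to time \<open>0\<close> before any null set is taken.
\<close>

lemma AE_hist_law:
  assumes u: "u \<in> policies_HR M" and s: "s \<in> states M"
  shows "t \<le> horizon M \<Longrightarrow> Measurable.pred (hist_space t) P \<Longrightarrow> (\<And>h. h \<in> histories M t \<Longrightarrow> P h)
    \<Longrightarrow> AE h in hist_law M s u t. P h"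
proof (induction t arbitrary: P)
  case 0
  then show ?case
    using init_hist_in_histories[OF s]
    unfolding hist_law.simps by (subst AE_return) (auto simp: init_hist_in_space)
next
  case (Suc t)
  then have t: "t < horizon M" by simp
  note [measurable] = Suc.prems(2)
  let ?K = "hist_kernel M u t" and ?L = "hist_law M s u t"
  let ?B = "{h' \<in> space (hist_space (Suc t)). \<not> P h'}"
  have sets_L: "sets ?L = sets (hist_space t)"
    using hist_law_in_prob_algebra[OF u, of t] t by (simp add: space_prob_algebra)
  have K[measurable]: "?K \<in> hist_space t \<rightarrow>\<^sub>M subprob_algebra (hist_space (Suc t))"
    by (rule measurable_prob_algebraD[OF hist_kernel_measurable[OF t u]])
  then have K': "?K \<in> ?L \<rightarrow>\<^sub>M subprob_algebra (hist_space (Suc t))"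
    by (simp add: measurable_cong_sets[OF sets_L refl])
  \<comment> \<open>Rewriting the almost sure statement as a null set of the kernel makes it
    measurable in \<open>h\<close>.\<close>
  have iff: "(AE h' in ?K h. P h') \<longleftrightarrow> emeasure (?K h) ?B = 0" if "h \<in> space (hist_space t)" for h
    using that sets_kernel[OF K that] subprob_measurableD(1)[OF K that]
    by (intro AE_iff_measurable) auto
  have [measurable]: "?B \<in> sets (hist_space (Suc t))" by measurable
  have "Measurable.pred (hist_space t) (\<lambda>h. emeasure (?K h) ?B = 0)"
    by measurable
  then have meas: "Measurable.pred (hist_space t) (\<lambda>h. AE h' in ?K h. P h')"
    by (rule measurable_cong[THEN iffD1, rotated]) (simp add: iff)
  \<comment> \<open>The induction hypothesis at the pulled back predicate leaves only genuine
    histories to check. There the action is almost surely admissible, so the extended history is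
    genuine again.\<close>
  have "AE h in ?L. AE h' in ?K h. P h'"
  proof (rule Suc.IH[OF _ meas])
    fix h assume h: "h \<in> histories M t"
    note hs = histories_subset_space[OF h]
    interpret N: prob_space "noise_law M t" by (rule prob_space_noise[OF t])
    interpret U: prob_space "u t h" by (rule prob_space_policy[OF t u hs])
    interpret pair_prob_space "u t h" "noise_law M t" ..
    note [measurable] = extend_hist_section_measurable[OF t u hs]
    have "AE a in u t h. a \<in> admissible M (cur_state t h)"
      using u t h by (auto simp: policies_HR_def)
    then have "AE a in u t h. AE x in noise_law M t. P (extend_hist M t h a x)"
      by eventually_elim
        (intro AE_I2 Suc.prems(3) extend_hist_in_histories[OF t h], auto simp: space_noise[OF t])
    then have "AE (a, x) in u t h \<Otimes>\<^sub>M noise_law M t. P (extend_hist M t h a x)"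
      by (intro AE_pair_measure) (auto simp: case_prod_unfold)
    then show "AE h' in ?K h. P h'"
      unfolding hist_kernel_def by (subst AE_distr_iff) (auto simp: case_prod_unfold)
  qed (use t in simp)
  then show ?case
    unfolding hist_law_Suc by (subst AE_bind[OF K']) auto
qed

end

subsection \<open>Dynamic programming\<close>

locale solvable_mdp = wf_mdp +
  assumes finite_exp: "finite_expectations M"
    and selection: "\<exists>w. inner_optimal M w"
begin

lemma stage_gain_integrable:
  "t < horizon M \<Longrightarrow> s \<in> states M \<Longrightarrow> a \<in> admissible M s \<Longrightarrow> integrable (noise_law M t) (stage_gain M t s y a)"
  using finite_exp by (auto simp: finite_expectations_def state_actions_def)

lemma value_fun_horizon: "value_fun M (horizon M) s y = - risk_aversion M * y\<^sup>2"
  by (simp add: value_fun_def)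

text \<open>Attained maxima make the conditionally complete \<open>SUP\<close> of
  \<open>value_rem\<close> a true maximum, so it never takes an unspecified value at a genuine
  state.\<close>

lemma value_fun_inner_optimal:
  assumes t: "t < horizon M" and s: "s \<in> states M" and w: "inner_optimal M w"
  shows "value_fun M t s y = (\<integral>x. stage_gain M t s y (w t s y) x \<partial>noise_law M t)"
proof -
  \<comment> \<open>\<open>value_rem\<close> is indexed by stages to go, so time \<open>t\<close>
    has to be translated back and forth.\<close>
  have eq: "horizon M - t = Suc (horizon M - Suc t)" "horizon M - Suc (horizon M - Suc t) = t"
    using t by auto
  have "value_fun M t s y = (SUP a\<in>admissible M s. \<integral>x. stage_gain M t s y a x \<partial>noise_law M t)"
    by (simp add: value_fun_def eq stage_gain_def)
  also have "\<dots> = (\<integral>x. stage_gain M t s y (w t s y) x \<partial>noise_law M t)"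
    using w t s by (intro cSup_eq_maximum) (auto simp: inner_optimal_def)
  finally show ?thesis .
qed

lemma stage_gain_le_value_fun:
  assumes t: "t < horizon M" and s: "s \<in> states M" and a: "a \<in> admissible M s"
  shows "(\<integral>x. stage_gain M t s y a x \<partial>noise_law M t) \<le> value_fun M t s y"
proof -
  obtain w where w: "inner_optimal M w" using selection by blast
  then show ?thesis
    using t s a by (subst value_fun_inner_optimal[OF t s w]) (auto simp: inner_optimal_def)
qed

text \<open>Backward induction. An inner optimal policy replaces the supremum over actions, which
  need not preserve measurability, by an integral along a measurable selector.\<close>

lemma value_version_exists:
  assumes "t \<le> horizon M"
  shows "\<exists>V. case_prod V \<in> borel_measurable (borel \<Otimes>\<^sub>M borel) \<and> (\<forall>s\<in>states M. \<forall>y. V s y = value_fun M t s y)"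
  using assms
proof (induction rule: inc_induct)
  case base
  show ?case
    by (intro exI[of _ "\<lambda>s y. - risk_aversion M * y\<^sup>2"] conjI) (auto simp: value_fun_horizon case_prod_unfold)
next
  case (step t)
  then obtain V where V[measurable]: "case_prod V \<in> borel_measurable (borel \<Otimes>\<^sub>M borel)"
    and V_eq: "\<And>s y. s \<in> states M \<Longrightarrow> V s y = value_fun M (Suc t) s y" by blast
  obtain w where w: "inner_optimal M w" using selection by blast
  interpret N: prob_space "noise_law M t" by (rule prob_space_noise[OF step(2)])
  have [measurable]: "case_prod (w t) \<in> borel_measurable (borel \<Otimes>\<^sub>M borel)"
    using w step(2) by (simp add: inner_optimal_def)
  let ?r = "\<lambda>s y x. reward M t s (w t s y) x" and ?f = "\<lambda>s y x. transition M t s (w t s y) x"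
  let ?V = "\<lambda>s y. \<integral>x. ?r s y x + V (?f s y x) (y - ?r s y x) \<partial>noise_law M t"
  let ?P = "(borel \<Otimes>\<^sub>M borel) \<Otimes>\<^sub>M noise_law M t"
  have k: "snd \<in> ?P \<rightarrow>\<^sub>M noise_space M"
    using measurable_snd by (simp add: measurable_cong_sets[OF refl sets_noise[OF step(2), symmetric]])
  have [measurable]: "(\<lambda>z. ?r (fst (fst z)) (snd (fst z)) (snd z)) \<in> borel_measurable ?P"
    by (rule reward_comp_measurable[OF step(2) _ _ k]) measurable
  have [measurable]: "(\<lambda>z. ?f (fst (fst z)) (snd (fst z)) (snd z)) \<in> borel_measurable ?P"
    by (rule transition_comp_measurable[OF step(2) _ _ k]) measurable
  have "(\<lambda>z. \<integral>x. ?r (fst z) (snd z) x + V (?f (fst z) (snd z) x) (snd z - ?r (fst z) (snd z) x) \<partial>noise_law M t)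
      \<in> borel_measurable (borel \<Otimes>\<^sub>M borel)"
    by (rule N.borel_measurable_lebesgue_integral) (simp add: case_prod_unfold, measurable)
  then have "case_prod ?V \<in> borel_measurable (borel \<Otimes>\<^sub>M borel)"
    by (simp add: case_prod_unfold)
  moreover have "?V s y = value_fun M t s y" if s: "s \<in> states M" for s y
    unfolding value_fun_inner_optimal[OF step(2) s w] stage_gain_def
    using w s step(2) transition_in_states[OF step(2) s] space_noise[OF step(2)]
    by (intro Bochner_Integration.integral_cong refl) (auto simp: inner_optimal_def intro!: V_eq)
  ultimately show ?case by blast
qed

text \<open>
  Off \<open>states M\<close> the value function is an unconstrained supremum and need not be measurable, so a
  Borel function that agrees with it on \<open>states M\<close> takes its place under the history laws.
\<close>

definition value_version :: "nat \<Rightarrow> real \<Rightarrow> real \<Rightarrow> real" where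
  "value_version t = (SOME V. case_prod V \<in> borel_measurable (borel \<Otimes>\<^sub>M borel) \<and>
     (\<forall>s\<in>states M. \<forall>y. V s y = value_fun M t s y))"

lemma value_version_measurable:
    "t \<le> horizon M \<Longrightarrow> case_prod (value_version t) \<in> borel_measurable (borel \<Otimes>\<^sub>M borel)"
  and value_version_eq:
    "t \<le> horizon M \<Longrightarrow> s \<in> states M \<Longrightarrow> value_version t s y = value_fun M t s y"
  using someI_ex[OF value_version_exists[of t]] unfolding value_version_def by auto

text \<open>Reward received so far plus the optimal value of the rest, with the target lowered by
  what has been received. Along the history laws this is a supermartingale under every policy and a
  martingale under a policy generated with target \<open>y\<close>.\<close>

definition total_value :: "real \<Rightarrow> nat \<Rightarrow> hist \<Rightarrow> real" where
  "total_value y t h = total_reward t h + value_version t (cur_state t h) (y - total_reward t h)"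

lemma total_value_measurable:
  assumes "t \<le> horizon M"
  shows "total_value y t \<in> borel_measurable (hist_space t)"
proof -
  note [measurable] = value_version_measurable[OF assms]
  show ?thesis unfolding total_value_def[abs_def] by measurable
qed

lemma total_value_extend:
  assumes t: "t < horizon M" and h: "h \<in> histories M t" and a: "a \<in> admissible M (cur_state t h)"
  shows "(\<integral>x. total_value y (Suc t) (extend_hist M t h a x) \<partial>noise_law M t)
    = total_reward t h + (\<integral>x. stage_gain M t (cur_state t h) (y - total_reward t h) a x \<partial>noise_law M t)"
proof -
  interpret N: prob_space "noise_law M t" by (rule prob_space_noise[OF t])
  note s = cur_state_in_states[OF h]
  have "(\<integral>x. total_value y (Suc t) (extend_hist M t h a x) \<partial>noise_law M t)
    = (\<integral>x. total_reward t h + stage_gain M t (cur_state t h) (y - total_reward t h) a x \<partial>noise_law M t)"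
    using t s a transition_in_states[OF t s a]
    by (intro Bochner_Integration.integral_cong refl)
       (simp add: total_value_def cur_state_extend_hist total_reward_extend_hist stage_gain_def
         value_version_eq space_noise algebra_simps)
  then show ?thesis
    using stage_gain_integrable[OF t s a] by (simp add: N.prob_space)
qed

lemma total_value_histories:
  assumes "t \<le> horizon M" "h \<in> histories M t"
  shows "total_value y t h = total_reward t h + value_fun M t (cur_state t h) (y - total_reward t h)"
  using assms by (simp add: total_value_def value_version_eq cur_state_in_states)

text \<open>A randomized action only averages stage gains, and each of them is at most the maximum
  that the value function records.\<close>

lemma kernel_total_value_le:
  assumes t: "t < horizon M" and u: "u \<in> policies_HR M" and h: "h \<in> histories M t"
    and int: "integrable (hist_kernel M u t h) (total_value y (Suc t))"
  shows "(\<integral>h'. total_value y (Suc t) h' \<partial>hist_kernel M u t h) \<le> total_value y t h"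
proof -
  note hs = histories_subset_space[OF h] and s = cur_state_in_states[OF h]
  interpret U: prob_space "u t h" by (rule prob_space_policy[OF t u hs])
  have "AE a in u t h. a \<in> admissible M (cur_state t h)"
    using u t h by (auto simp: policies_HR_def)
  then have "AE a in u t h. (\<integral>x. total_value y (Suc t) (extend_hist M t h a x) \<partial>noise_law M t)
      \<le> total_value y t h"
    by eventually_elim
      (use t h s in \<open>simp add: total_value_extend total_value_histories stage_gain_le_value_fun\<close>)
  then have "(\<integral>a. (\<integral>x. total_value y (Suc t) (extend_hist M t h a x) \<partial>noise_law M t) \<partial>u t h)
      \<le> (\<integral>a. total_value y t h \<partial>u t h)"
    using integrable_hist_kernel[OF t u hs int] by (intro integral_mono_AE) auto
  then show ?thesis
    by (simp add: integral_hist_kernel[OF t u hs int] U.prob_space)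
qed

text \<open>The generated action is deterministic and attains the maximum, so the supermartingale
  inequality becomes an equality.\<close>

lemma kernel_total_value_generated:
  assumes t: "t < horizon M" and u: "u \<in> policies_HR M" and h: "h \<in> histories M t"
    and int: "integrable (hist_kernel M u t h) (total_value y (Suc t))"
    and w: "inner_optimal M w" and u_t: "u t = randomize (generated w y) t"
  shows "(\<integral>h'. total_value y (Suc t) h' \<partial>hist_kernel M u t h) = total_value y t h"
proof -
  note hs = histories_subset_space[OF h] and s = cur_state_in_states[OF h]
  let ?a = "generated w y t h"
  have u_th: "u t h = return borel ?a" by (simp add: u_t randomize_def)
  have a: "?a \<in> admissible M (cur_state t h)"
    using generated_in_policies_HD[OF w] t h by (auto simp: policies_HD_def)
  have "(\<integral>h'. total_value y (Suc t) h' \<partial>hist_kernel M u t h)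
      = (\<integral>x. total_value y (Suc t) (extend_hist M t h ?a x) \<partial>noise_law M t)"
    using borel_measurable_integrable[OF integrable_hist_kernel[OF t u hs int]]
    by (simp add: integral_hist_kernel[OF t u hs int] u_th integral_return)
  also have "\<dots> = total_value y t h"
    using t h s a
    by (simp add: total_value_extend total_value_histories value_fun_inner_optimal[OF t s w] generated_def)
  finally show ?thesis .
qed

end

context solvable_mdp
begin

text \<open>For a general policy the kernel average is only a lower bound of
  \<open>total_value y t\<close>, so integrability at time \<open>t\<close> must be supplied. For a
  generated action the two agree almost surely, and integrability passes backwards in time.\<close>

lemma total_value_step:
  assumes t: "t < horizon M" and u: "u \<in> policies_HR M" and s: "s \<in> states M"
    and int: "integrable (hist_law M s u (Suc t)) (total_value y (Suc t))"
  shows "integrable (hist_law M s u t) (total_value y t) \<Longrightarrow>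
      (\<integral>h. total_value y (Suc t) h \<partial>hist_law M s u (Suc t)) \<le> (\<integral>h. total_value y t h \<partial>hist_law M s u t)"
    and "inner_optimal M w \<Longrightarrow> u t = randomize (generated w y) t \<Longrightarrow>
      integrable (hist_law M s u t) (total_value y t) \<and>
      (\<integral>h. total_value y (Suc t) h \<partial>hist_law M s u (Suc t)) = (\<integral>h. total_value y t h \<partial>hist_law M s u t)"
proof -
  let ?L = "hist_law M s u t" and ?K = "hist_kernel M u t"
  let ?G = "\<lambda>h. \<integral>h'. total_value y (Suc t) h' \<partial>?K h"
  have "?L \<in> space (prob_algebra (hist_space t))"
    using hist_law_in_prob_algebra[OF u, of t] t by simp
  then have sets_L: "sets ?L = sets (hist_space t)" and "prob_space ?L"
    by (simp_all add: space_prob_algebra)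
  then have ne: "space ?L \<noteq> {}" by (simp add: prob_space.not_empty)
  have K[measurable]: "?K \<in> hist_space t \<rightarrow>\<^sub>M subprob_algebra (hist_space (Suc t))"
    by (rule measurable_prob_algebraD[OF hist_kernel_measurable[OF t u]])
  then have K': "?K \<in> ?L \<rightarrow>\<^sub>M subprob_algebra (hist_space (Suc t))"
    by (simp add: measurable_cong_sets[OF sets_L refl])
  have [measurable]: "total_value y t \<in> borel_measurable (hist_space t)"
    "total_value y (Suc t) \<in> borel_measurable (hist_space (Suc t))"
    using t by (auto intro: total_value_measurable)
  have meas_L: "total_value y t \<in> borel_measurable ?L"
    by (simp add: measurable_cong_sets[OF sets_L refl])
  have [measurable]: "?G \<in> borel_measurable (hist_space t)"
    by measurable
  have [measurable]: "Measurable.pred (hist_space t) (\<lambda>h. integrable (?K h) (total_value y (Suc t)))"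
    by measurable
  note bind_int = int[unfolded hist_law_Suc]
  have G: "integrable ?L ?G"
    "(\<integral>h. total_value y (Suc t) h \<partial>hist_law M s u (Suc t)) = (\<integral>h. ?G h \<partial>?L)"
    using integrable_integral_kernel[OF K' ne bind_int] integral_bind_integrable[OF K' ne bind_int]
    unfolding hist_law_Suc by simp_all
  have AE_int: "AE h in ?L. integrable (?K h) (total_value y (Suc t))"
    by (rule AE_integrable_bind_kernel[OF K' ne bind_int])
  show "(\<integral>h. total_value y (Suc t) h \<partial>hist_law M s u (Suc t)) \<le> (\<integral>h. total_value y t h \<partial>?L)"
    if "integrable ?L (total_value y t)"
  proof -
    \<comment> \<open>Integrability under the kernel is known almost surely only, whereas
      \<open>AE_hist_law\<close> needs a measurable predicate true on all genuine histories; hence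
      the implication, discharged afterwards by \<open>AE_int\<close>.\<close>
    have "AE h in ?L. integrable (?K h) (total_value y (Suc t)) \<longrightarrow> ?G h \<le> total_value y t h"
      using t kernel_total_value_le[OF t u] by (intro AE_hist_law[OF u s]) auto
    with AE_int have "AE h in ?L. ?G h \<le> total_value y t h" by eventually_elim auto
    then show ?thesis unfolding G(2) by (rule integral_mono_AE[OF G(1) that])
  qed
  show "integrable ?L (total_value y t) \<and>
      (\<integral>h. total_value y (Suc t) h \<partial>hist_law M s u (Suc t)) = (\<integral>h. total_value y t h \<partial>?L)"
    if w: "inner_optimal M w" "u t = randomize (generated w y) t"
  proof -
    have "AE h in ?L. integrable (?K h) (total_value y (Suc t)) \<longrightarrow> ?G h = total_value y t h"
      using t kernel_total_value_generated[OF t u _ _ w] by (intro AE_hist_law[OF u s]) auto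
    with AE_int have "AE h in ?L. ?G h = total_value y t h" by eventually_elim auto
    with G show ?thesis
      using integrable_cong_AE[OF borel_measurable_integrable[OF G(1)] meas_L]
        integral_cong_AE[OF borel_measurable_integrable[OF G(1)] meas_L] by simp
  qed
qed

section \<open>Moments of the total reward and optimality of dynamic programming\<close>

lemma
  assumes u: "u \<in> policies_HR M" and s: "s \<in> states M"
  shows prob_space_hist_law: "t \<le> horizon M \<Longrightarrow> prob_space (hist_law M s u t)"
    and integrable_total_reward: "integrable (hist_law M s u (horizon M)) (total_reward (horizon M))"
    and integrable_total_reward_sq:
      "integrable (hist_law M s u (horizon M)) (\<lambda>h. (total_reward (horizon M) h)\<^sup>2)"
  using hist_law_in_prob_algebra[OF u, of t s] finite_exp u s
  by (auto simp: space_prob_algebra finite_expectations_def)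

lemma integrable_total_reward_quadratic:
  assumes u: "u \<in> policies_HR M" and s: "s \<in> states M"
  shows "integrable (hist_law M s u (horizon M))
    (\<lambda>h. a + b * total_reward (horizon M) h + c * (total_reward (horizon M) h)\<^sup>2)"
proof -
  interpret prob_space "hist_law M s u (horizon M)" by (rule prob_space_hist_law[OF u s]) simp
  show ?thesis
    using integrable_total_reward[OF u s] integrable_total_reward_sq[OF u s] by simp
qed

lemma expect_quadratic:
  assumes u: "u \<in> policies_HR M" and s: "s \<in> states M"
  shows "expect M s u (\<lambda>R. a + b * R + c * R\<^sup>2) = a + b * mean M s u + c * expect M s u (\<lambda>R. R\<^sup>2)"
proof -
  interpret prob_space "hist_law M s u (horizon M)" by (rule prob_space_hist_law[OF u s]) simp
  show ?thesis
    using integrable_total_reward[OF u s] integrable_total_reward_sq[OF u s]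
    by (simp add: expect_def mean_def prob_space)
qed

text \<open>Bias-variance decomposition of the squared deviation from \<open>y\<close>: both
  criteria are determined by the first two moments of the total reward.\<close>

lemma Jhat_eq:
  assumes u: "u \<in> policies_HR M" and s: "s \<in> states M"
  shows "Jhat M s y u = J M s u - risk_aversion M * (y - mean M s u)\<^sup>2"
proof -
  let ?l = "risk_aversion M" and ?m = "mean M s u" and ?q = "expect M s u (\<lambda>R. R\<^sup>2)"
  have "Jhat M s y u = expect M s u (\<lambda>R. (- ?l * y\<^sup>2) + (1 + 2 * ?l * y) * R + (- ?l) * R\<^sup>2)"
    unfolding Jhat_def by (rule arg_cong[of _ _ "expect M s u"]) (auto simp: power2_eq_square algebra_simps)
  also have "\<dots> = (- ?l * y\<^sup>2) + (1 + 2 * ?l * y) * ?m + (- ?l) * ?q"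
    by (rule expect_quadratic[OF u s])
  finally have Jhat: "Jhat M s y u = (- ?l * y\<^sup>2) + (1 + 2 * ?l * y) * ?m + (- ?l) * ?q" .
  have "var M s u = expect M s u (\<lambda>R. ?m\<^sup>2 + (- 2 * ?m) * R + 1 * R\<^sup>2)"
    unfolding var_def by (rule arg_cong[of _ _ "expect M s u"]) (auto simp: power2_eq_square algebra_simps)
  also have "\<dots> = ?m\<^sup>2 + (- 2 * ?m) * ?m + 1 * ?q"
    by (rule expect_quadratic[OF u s])
  finally have var: "var M s u = ?q - ?m\<^sup>2"
    by (simp add: power2_eq_square)
  show ?thesis
    unfolding Jhat J_def var by (simp add: power2_eq_square algebra_simps)
qed

lemma
  assumes u: "u \<in> policies_HR M" and s: "s \<in> states M"
  shows integrable_total_value_horizon: "integrable (hist_law M s u (horizon M)) (total_value y (horizon M))"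
    and integral_total_value_horizon:
      "(\<integral>h. total_value y (horizon M) h \<partial>hist_law M s u (horizon M)) = Jhat M s y u"
proof -
  let ?L = "hist_law M s u (horizon M)" and ?l = "risk_aversion M" and ?R = "total_reward (horizon M)"
  let ?Q = "\<lambda>h. ?R h - ?l * (?R h - y)\<^sup>2"
  have sets_L: "sets ?L = sets (hist_space (horizon M))"
    using hist_law_in_prob_algebra[OF u, of "horizon M"] by (simp add: space_prob_algebra)
  note [measurable] = total_value_measurable[OF order_refl]
  have "?Q = (\<lambda>h. (- ?l * y\<^sup>2) + (1 + 2 * ?l * y) * ?R h + (- ?l) * (?R h)\<^sup>2)"
    by (auto simp: power2_eq_square algebra_simps)
  then have Q: "integrable ?L ?Q"
    using integrable_total_reward_quadratic[OF u s, of "- ?l * y\<^sup>2" "1 + 2 * ?l * y" "- ?l"] by simp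
  \<comment> \<open>The Borel version equals the terminal value on genuine states only, so the
    identity holds almost surely.\<close>
  have eq: "AE h in ?L. ?Q h = total_value y (horizon M) h"
    by (rule AE_hist_law[OF u s])
      (auto simp: total_value_histories value_fun_horizon power2_commute)
  have meas: "total_value y (horizon M) \<in> borel_measurable ?L"
    by (simp add: measurable_cong_sets[OF sets_L refl])
  note cong = borel_measurable_integrable[OF Q] meas eq
  show "integrable ?L (total_value y (horizon M))"
    using integrable_cong_AE[OF cong] Q by simp
  show "(\<integral>h. total_value y (horizon M) h \<partial>?L) = Jhat M s y u"
    using integral_cong_AE[OF cong] by (simp add: Jhat_def expect_def)
qed

text \<open>The martingale property, followed backwards from the horizon as long as the policy is
  the generated one. Time 0 gives the value of the generated policy; a later \<open>t\<close> gives
  integrability when an arbitrary policy is continued optimally.\<close>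

lemma total_value_generated_tail:
  assumes u: "u \<in> policies_HR M" and s: "s \<in> states M" and w: "inner_optimal M w"
    and tail: "\<And>i. t \<le> i \<Longrightarrow> u i = randomize (generated w y) i" and t: "t \<le> horizon M"
  shows "integrable (hist_law M s u t) (total_value y t) \<and>
    (\<integral>h. total_value y t h \<partial>hist_law M s u t) = Jhat M s y u"
  using t tail
proof (induction rule: inc_induct)
  case base
  show ?case using integrable_total_value_horizon[OF u s] integral_total_value_horizon[OF u s] by simp
next
  case (step n)
  then have "integrable (hist_law M s u (Suc n)) (total_value y (Suc n)) \<and>
    (\<integral>h. total_value y (Suc n) h \<partial>hist_law M s u (Suc n)) = Jhat M s y u"
    by auto
  then show ?case
    using total_value_step(2)[OF step(2) u s _ w step(4)] by auto
qed

lemma integral_total_value_0: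
  assumes u: "u \<in> policies_HR M" and s: "s \<in> states M"
  shows "(\<integral>h. total_value y 0 h \<partial>hist_law M s u 0) = value_fun M 0 s y"
proof -
  have "(\<integral>h. total_value y 0 h \<partial>hist_law M s u 0) = total_value y 0 (init_hist s)"
    unfolding hist_law.simps
    by (rule integral_return) (auto simp: init_hist_in_space total_value_measurable)
  then show ?thesis
    using init_hist_in_histories[OF s]
    by (simp add: total_value_histories) (simp add: init_hist_def cur_state_def total_reward_def)
qed

lemma Jhat_generated:
  assumes s: "s \<in> states M" and w: "inner_optimal M w"
  shows "Jhat M s y (randomize (generated w y)) = value_fun M 0 s y"
proof -
  have u: "randomize (generated w y) \<in> policies_HR M"
    by (intro randomize_in_policies_HR generated_in_policies_HD w)
  show ?thesis
    using total_value_generated_tail[OF u s w, of 0 y] integral_total_value_0[OF u s] by simp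
qed

text \<open>
  A policy followed up to time \<open>t\<close> and continued optimally has the same law of \<open>t\<close>-histories, which
  transfers the assumed integrability of the total reward to the value at time \<open>t\<close>.
\<close>

lemma integrable_total_value:
  assumes u: "u \<in> policies_HR M" and s: "s \<in> states M" and t: "t \<le> horizon M"
  shows "integrable (hist_law M s u t) (total_value y t)"
proof -
  obtain w where w: "inner_optimal M w" using selection by blast
  define v where "v i = (if i < t then u i else randomize (generated w y) i)" for i
  have "randomize (generated w y) \<in> policies_HR M"
    by (intro randomize_in_policies_HR generated_in_policies_HD w)
  with u have v: "v \<in> policies_HR M"
    unfolding policies_HR_def by (auto simp only: v_def split: if_split)
  have "hist_law M s v t = hist_law M s u t"
    by (rule hist_law_cong) (simp add: v_def)
  then show ?thesis
    using total_value_generated_tail[OF v s w _ t, of y] by (simp add: v_def)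
qed

text \<open>Under any policy the expected \<open>total_value\<close> does not increase in time; it
  starts at the value function and ends at \<open>Jhat\<close>.\<close>

lemma Jhat_le_value_fun:
  assumes u: "u \<in> policies_HR M" and s: "s \<in> states M"
  shows "Jhat M s y u \<le> value_fun M 0 s y"
proof -
  have "(\<integral>h. total_value y t h \<partial>hist_law M s u t) \<le> value_fun M 0 s y" if "t \<le> horizon M" for t
    using that
  proof (induction t)
    case 0
    then show ?case using integral_total_value_0[OF u s] by simp
  next
    case (Suc t)
    then show ?case
      using total_value_step(1)[OF _ u s, of t y] integrable_total_value[OF u s] by force
  qed
  from this[of "horizon M"] show ?thesis
    using integral_total_value_horizon[OF u s] by simp
qed

lemma J_le_value_fun:
  assumes u: "u \<in> policies_HR M" and s: "s \<in> states M"
  shows "J M s u \<le> value_fun M 0 s (mean M s u)"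
  using Jhat_le_value_fun[OF u s, of "mean M s u"] Jhat_eq[OF u s, of "mean M s u"] by simp

end

subsection \<open>Concavity and gradient ascent\<close>

text \<open>
  The minorant is tangent at \<open>y\<close>: comparing it with the concave \<open>g\<close> on the far side of \<open>y\<close> from \<open>z\<close>
  leaves its slope as the only supergradient of \<open>g\<close> at \<open>y\<close>.
\<close>

lemma concave_supergradient_of_quadratic_minorant:
  fixes g :: "real \<Rightarrow> real"
  assumes g: "concave_on UNIV g"
    and minorant: "\<And>x. A - l * (x - m)\<^sup>2 \<le> g x" and tangent: "g y = A - l * (y - m)\<^sup>2"
  shows "g z \<le> g y + 2 * l * (m - y) * (z - y)"
proof -
  have bound: "g z \<le> g y + 2 * l * (m - y) * (z - y) + l * e * (z - y)\<^sup>2" if e: "e > 0" for e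
  proof -
    \<comment> \<open>The point \<open>?x\<close> lies beyond \<open>y\<close> as seen from
      \<open>z\<close>, and the weights \<open>?p\<close>, \<open>?q\<close> recover
      \<open>y\<close>. Concavity then bounds \<open>g z\<close> by \<open>g y\<close> and the
      minorant at \<open>?x\<close>.\<close>
    let ?x = "y - e * (z - y)"
    let ?p = "1 / (1 + e)" and ?q = "e / (1 + e)"
    have pq: "?p + ?q = 1" "?p \<ge> 0" "?q \<ge> 0" using e by (auto simp: field_simps)
    have comb: "?p * ?x + ?q * z = y"
    proof -
      have "?p * ?x + ?q * z = (?x + e * z) / (1 + e)" by (simp add: add_divide_distrib)
      also have "\<dots> = y" using e by (simp add: field_simps)
      finally show ?thesis .
    qed
    have "?p * g ?x + ?q * g z \<le> g (?p * ?x + ?q * z)"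
      using concave_onD[OF g, of ?q ?x z] pq e by (simp add: field_simps)
    then have "(g ?x + e * g z) / (1 + e) \<le> g y"
      unfolding comb by (simp add: add_divide_distrib)
    then have "g ?x + e * g z \<le> (1 + e) * g y"
      using e by (simp add: field_simps)
    then have "e * g z \<le> e * g y + g y - (A - l * (?x - m)\<^sup>2)"
      using minorant[of ?x] by (simp add: algebra_simps)
    also have "\<dots> = e * (g y + 2 * l * (m - y) * (z - y) + l * e * (z - y)\<^sup>2)"
      unfolding tangent by (simp add: power2_eq_square algebra_simps)
    finally show ?thesis using e by simp
  qed
  \<comment> \<open>Letting \<open>e\<close> tend to 0 from the right removes the quadratic
    remainder.\<close>
  have "((\<lambda>e. g y + 2 * l * (m - y) * (z - y) + l * e * (z - y)\<^sup>2)
      \<longlongrightarrow> g y + 2 * l * (m - y) * (z - y) + l * 0 * (z - y)\<^sup>2) (at_right 0)"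
    by (intro tendsto_intros)
  moreover have "\<forall>\<^sub>F e in at_right 0. g z \<le> g y + 2 * l * (m - y) * (z - y) + l * e * (z - y)\<^sup>2"
    using eventually_at_right_less[of "0::real"] by eventually_elim (rule bound)
  ultimately have "g z \<le> g y + 2 * l * (m - y) * (z - y) + l * 0 * (z - y)\<^sup>2"
    by (rule tendsto_lowerbound) simp
  then show ?thesis by simp
qed

context solvable_mdp
begin

text \<open>Backward induction with concavity joint in state and target, since a transition moves
  both at once. Affine substitution, integration over the noise and partial maximization over a
  convex set of pairs all preserve concavity.\<close>

lemma value_fun_concave:
  assumes convex: "convex (states M)" "convex (state_actions M)"
    and linear_f: "\<And>t s a x. t < horizon M \<Longrightarrow> (s, a) \<in> state_actions M \<Longrightarrow>
      x \<in> space (noise_space M) \<Longrightarrow> transition M t s a x = f1 t x * s + f2 t x * a + f3 t x"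
    and linear_r: "\<And>t s a x. t < horizon M \<Longrightarrow> (s, a) \<in> state_actions M \<Longrightarrow>
      x \<in> space (noise_space M) \<Longrightarrow> reward M t s a x = r1 t x * s + r2 t x * a + r3 t x"
    and t: "t \<le> horizon M"
  shows "concave_on (states M \<times> UNIV) (\<lambda>(s, y). value_fun M t s y)"
  using t
proof (induction rule: inc_induct)
  case base
  have "risk_aversion M * (p * y + q * y')\<^sup>2 \<le> p * (risk_aversion M * y\<^sup>2) + q * (risk_aversion M * y'\<^sup>2)"
    if "p \<ge> 0" "q \<ge> 0" "p + q = 1" for p q y y' :: real
  proof -
    have "(p * y + q * y')\<^sup>2 \<le> p * y\<^sup>2 + q * y'\<^sup>2"
      using convex_onD[OF convex_power2, of q y y'] that by (simp add: eq_diff_eq[symmetric] add.commute)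
    moreover have "0 \<le> risk_aversion M" using mdp by (simp add: mv_mdp_def)
    ultimately have "risk_aversion M * (p * y + q * y')\<^sup>2 \<le> risk_aversion M * (p * y\<^sup>2 + q * y'\<^sup>2)"
      by (rule mult_left_mono)
    then show ?thesis by (simp add: algebra_simps)
  qed
  note ineq = this
  show ?case
    unfolding concave_on_iff
  proof (intro conjI ballI allI impI)
    show "convex (states M \<times> (UNIV :: real set))" using convex(1) by (intro convex_Times) auto
    fix z z' :: "real \<times> real" and p q :: real
    assume "0 \<le> p" "0 \<le> q" "p + q = 1"
    from ineq[OF this, of "snd z" "snd z'"]
    show "p * (case z of (s, y) \<Rightarrow> value_fun M (horizon M) s y)
          + q * (case z' of (s, y) \<Rightarrow> value_fun M (horizon M) s y)
        \<le> (case p *\<^sub>R z + q *\<^sub>R z' of (s, y) \<Rightarrow> value_fun M (horizon M) s y)"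
      by (simp add: value_fun_horizon case_prod_unfold)
  qed
next
  case (step n)
  let ?V = "value_fun M"
  obtain w where w: "inner_optimal M w" using selection by blast
  show ?case
    unfolding concave_on_iff
  proof (intro conjI ballI allI impI)
    show "convex (states M \<times> (UNIV :: real set))" using convex(1) by (intro convex_Times) auto
    fix z z' :: "real \<times> real" and p q :: real
    assume z: "z \<in> states M \<times> UNIV" "z' \<in> states M \<times> UNIV" and pq: "0 \<le> p" "0 \<le> q" "p + q = 1"
    have p: "p = 1 - q" using pq by simp
    obtain s y s' y' where [simp]: "z = (s, y)" "z' = (s', y')" by fastforce
    have s: "s \<in> states M" "s' \<in> states M" using z by auto
    \<comment> \<open>Maximizers at the two endpoints. Convexity of \<open>state_actions M\<close>
      makes their mixture feasible at the mixed state; it need not be maximal there, which accounts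
      for the last inequality below.\<close>
    define a a' where "a = w n s y" and "a' = w n s' y'"
    have a: "a \<in> admissible M s" "a' \<in> admissible M s'"
      using w s step(2) by (auto simp: inner_optimal_def a_def a'_def)
    define s0 a0 y0 where "s0 = p * s + q * s'" and "a0 = p * a + q * a'" and "y0 = p * y + q * y'"
    have sa: "(s, a) \<in> state_actions M" "(s', a') \<in> state_actions M"
      using s a by (auto simp: state_actions_def)
    have "p *\<^sub>R (s, a) + q *\<^sub>R (s', a') \<in> state_actions M"
      using convexD[OF convex(2) sa pq] .
    then have sa0: "(s0, a0) \<in> state_actions M" by (simp add: s0_def a0_def)
    then have s0: "s0 \<in> states M" and a0: "a0 \<in> admissible M s0" by (auto simp: state_actions_def)
    \<comment> \<open>Next state, reward and shifted target are affine along the segment, so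
      concavity at stage \<open>Suc n\<close> carries over for each noise value.\<close>
    have pointwise: "p * stage_gain M n s y a x + q * stage_gain M n s' y' a' x \<le> stage_gain M n s0 y0 a0 x"
      if "x \<in> space (noise_law M n)" for x
    proof -
      have x: "x \<in> space (noise_space M)" using that space_noise[OF step(2)] by simp
      let ?f = "transition M n" and ?r = "reward M n"
      have f: "?f s0 a0 x = p * ?f s a x + q * ?f s' a' x"
        unfolding linear_f[OF step(2) sa(1) x] linear_f[OF step(2) sa(2) x] linear_f[OF step(2) sa0 x]
        unfolding s0_def a0_def p by (simp add: algebra_simps)
      have r: "?r s0 a0 x = p * ?r s a x + q * ?r s' a' x"
        unfolding linear_r[OF step(2) sa(1) x] linear_r[OF step(2) sa(2) x] linear_r[OF step(2) sa0 x]
        unfolding s0_def a0_def p by (simp add: algebra_simps)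
      have "?f s a x \<in> states M" "?f s' a' x \<in> states M"
        using transition_in_states[OF step(2)] s a x by auto
      then have "p * ?V (Suc n) (?f s a x) (y - ?r s a x) + q * ?V (Suc n) (?f s' a' x) (y' - ?r s' a' x)
          \<le> ?V (Suc n) (p * ?f s a x + q * ?f s' a' x) (p * (y - ?r s a x) + q * (y' - ?r s' a' x))"
        using step(3) pq unfolding concave_on_iff by fastforce
      also have "p * (y - ?r s a x) + q * (y' - ?r s' a' x) = y0 - ?r s0 a0 x"
        by (simp add: r y0_def algebra_simps)
      finally show ?thesis
        by (simp add: stage_gain_def f[symmetric]) (simp add: r algebra_simps)
    qed
    note int = stage_gain_integrable[OF step(2)]
    have "p * ?V n s y + q * ?V n s' y'
        = (\<integral>x. p * stage_gain M n s y a x + q * stage_gain M n s' y' a' x \<partial>noise_law M n)"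
      using int[OF s(1) a(1)] int[OF s(2) a(2)]
      by (simp add: value_fun_inner_optimal[OF step(2) _ w] s a_def a'_def)
    also have "\<dots> \<le> (\<integral>x. stage_gain M n s0 y0 a0 x \<partial>noise_law M n)"
      using int[OF s(1) a(1)] int[OF s(2) a(2)] int[OF s0 a0] pointwise by (intro integral_mono) auto
    also have "\<dots> \<le> ?V n s0 y0"
      by (rule stage_gain_le_value_fun[OF step(2) s0 a0])
    finally show "p * (case z of (s, y) \<Rightarrow> ?V n s y) + q * (case z' of (s, y) \<Rightarrow> ?V n s y)
        \<le> (case p *\<^sub>R z + q *\<^sub>R z' of (s, y) \<Rightarrow> ?V n s y)"
      by (simp add: s0_def y0_def)
  qed
qed

text \<open>\<open>same_policy\<close> compares policies on genuine histories only, but the history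
  laws live there almost surely, so the step kernels agree almost everywhere.\<close>

lemma hist_law_cong_same_policy:
  assumes u: "u \<in> policies_HD M" and v: "v \<in> policies_HD M" and s: "s \<in> states M"
    and same: "same_policy M u v"
  shows "hist_law M s (randomize u) (horizon M) = hist_law M s (randomize v) (horizon M)"
proof -
  have "hist_law M s (randomize u) t = hist_law M s (randomize v) t" if "t \<le> horizon M" for t
    using that
  proof (induction t)
    case (Suc t)
    let ?L = "hist_law M s (randomize u) t"
    note HR = u[THEN randomize_in_policies_HR] v[THEN randomize_in_policies_HR]
    have L: "?L \<in> space (prob_algebra (hist_space t))" "t < horizon M"
      using hist_law_in_prob_algebra[OF HR(1), of t] Suc.prems by simp_all
    then have sets_L: "sets ?L = sets (hist_space t)" by (simp add: space_prob_algebra)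
    have [measurable]: "u t \<in> borel_measurable (hist_space t)" "v t \<in> borel_measurable (hist_space t)"
      using u v L(2) by (auto simp: policies_HD_def)
    have "AE h in ?L. u t h = v t h"
      using L(2) same by (intro AE_hist_law[OF HR(1) s]) (auto simp: same_policy_def)
    then have "AE h in ?L. hist_kernel M (randomize u) t h = hist_kernel M (randomize v) t h"
      by eventually_elim (simp add: hist_kernel_def randomize_def)
    then have "?L \<bind> hist_kernel M (randomize u) t = ?L \<bind> hist_kernel M (randomize v) t"
      using hist_kernel_measurable[OF L(2) HR(1)] hist_kernel_measurable[OF L(2) HR(2)]
      by (intro bind_cong_AE'[OF L(1)]) auto
    then show ?case using Suc by (simp only: hist_law_Suc)
  qed simp
  then show ?thesis by simp
qed

end

text \<open>Improvement and restart share this form, so every run is one uniform iteration: generate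
  from some inner optimal policy with the current pseudo mean as target.\<close>

lemma alg_step_generated:
  assumes "alg_step M Y s u w k"
  shows "inner_optimal M (w k)" "u (Suc k) = generated (w k) (pseudo_mean M s (u k))"
  using assms by (auto simp: alg_step_def restart_def improvement_def split: if_splits)

section \<open>Runs of the algorithm: monotonicity, stopping and convergence\<close>

context solvable_mdp
begin

lemma J_le_J_opt:
  assumes "u \<in> policies_HD M"
  shows "ereal (J M s (randomize u)) \<le> J_opt M s"
  unfolding J_opt_def using randomize_in_policies_HR[OF assms] by (rule SUP_upper)

lemma mean_cong_same_policy:
  assumes "u \<in> policies_HD M" "v \<in> policies_HD M" "s \<in> states M" "same_policy M u v"
  shows "mean M s (randomize u) = mean M s (randomize v)"
  using hist_law_cong_same_policy[OF assms] by (simp add: mean_def expect_def)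

lemma alg_run_policies_HD:
  assumes run: "alg_run M Y s u w n"
  shows "k \<le> n \<Longrightarrow> u k \<in> policies_HD M"
proof (cases k)
  case (Suc j)
  moreover assume "k \<le> n"
  ultimately have "alg_step M Y s u w j" using run by (simp add: alg_run_def)
  from alg_step_generated[OF this] show ?thesis
    using Suc by (simp add: generated_in_policies_HD)
qed (use run in \<open>simp add: alg_run_def\<close>)

context
  fixes s :: real
  assumes s: "s \<in> states M" and concave: "concave_on UNIV (value_fun M 0 s)"
begin

text \<open>
  A policy improvement step is a gradient ascent step of length \<open>1 / (2 * risk_aversion M)\<close> for the
  concave function \<open>value_fun M 0 s\<close>, and this is its usual telescoping estimate.
\<close>

lemma value_fun_le_J_generated:
  fixes y z :: real
  assumes w: "inner_optimal M w"
  defines "u \<equiv> randomize (generated w y)"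
  shows "value_fun M 0 s z \<le> J M s u + risk_aversion M * ((z - y)\<^sup>2 - (z - mean M s u)\<^sup>2)"
proof -
  have u: "u \<in> policies_HR M"
    unfolding u_def by (intro randomize_in_policies_HR generated_in_policies_HD w)
  \<comment> \<open>The generated policy attains the value function at its own target
    \<open>y\<close>, so its parabola touches there.\<close>
  have tangent: "value_fun M 0 s y = J M s u - risk_aversion M * (y - mean M s u)\<^sup>2"
    using Jhat_generated[OF s w, of y] Jhat_eq[OF u s, of y] by (simp add: u_def)
  have "value_fun M 0 s z \<le> value_fun M 0 s y + 2 * risk_aversion M * (mean M s u - y) * (z - y)"
    by (rule concave_supergradient_of_quadratic_minorant[OF concave _ tangent])
      (use Jhat_le_value_fun[OF u s] Jhat_eq[OF u s] in simp)
  \<comment> \<open>Completing the square turns the linear term into a difference of squared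
    distances to \<open>z\<close>, the form that telescopes.\<close>
  also have "\<dots> = J M s u + risk_aversion M * ((z - y)\<^sup>2 - (z - mean M s u)\<^sup>2)"
    unfolding tangent by (simp add: power2_eq_square algebra_simps)
  finally show ?thesis .
qed

text \<open>The old value is at most the value function at the old mean; the new policy attains that
  in the pseudo problem, and replacing the target by its own mean only removes a nonnegative
  penalty.\<close>

lemma J_mono_step:
  assumes u: "u \<in> policies_HD M" and w: "inner_optimal M w"
  shows "J M s (randomize u) \<le> J M s (randomize (generated w (pseudo_mean M s u)))"
proof -
  let ?y = "pseudo_mean M s u" and ?u' = "randomize (generated w (pseudo_mean M s u))"
  have "J M s (randomize u) \<le> value_fun M 0 s ?y"
    using J_le_value_fun[OF randomize_in_policies_HR[OF u] s] by (simp add: pseudo_mean_def)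
  also have "\<dots> = Jhat M s ?y ?u'" by (rule Jhat_generated[OF s w, symmetric])
  also have "\<dots> \<le> J M s ?u'"
    using mdp by (subst Jhat_eq[OF _ s])
      (auto simp: mv_mdp_def intro!: randomize_in_policies_HR generated_in_policies_HD w)
  finally show ?thesis .
qed

text \<open>A repeated policy has its own mean as target, so the two squared distances in the ascent
  estimate cancel and its \<open>J\<close> dominates the value function at every \<open>z\<close>,
  hence the \<open>J\<close> of every policy.\<close>

lemma stopped_optimal:
  assumes stops: "alg_stops M Y s u w n"
  shows "ereal (J M s (randomize (u n))) = J_opt M s"
proof (rule antisym)
  have run: "alg_run M Y s u w n" and n: "0 < n" and same: "same_policy M (u n) (u (n - 1))"
    using stops by (auto simp: alg_stops_def loop_ended_def)
  note HD = alg_run_policies_HD[OF run]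
  have "alg_step M Y s u w (n - 1)" using run n by (simp add: alg_run_def)
  from alg_step_generated[OF this] n
  have w: "inner_optimal M (w (n - 1))"
    and u_n: "u n = generated (w (n - 1)) (pseudo_mean M s (u (n - 1)))" by simp_all
  have "pseudo_mean M s (u (n - 1)) = mean M s (randomize (u n))"
    using mean_cong_same_policy[OF HD HD s same] by (simp add: pseudo_mean_def)
  then have le: "value_fun M 0 s z \<le> J M s (randomize (u n))" for z
    using value_fun_le_J_generated[OF w, of z "pseudo_mean M s (u (n - 1))"]
    unfolding u_n[symmetric] by simp
  show "J_opt M s \<le> ereal (J M s (randomize (u n)))"
    unfolding J_opt_def
    by (rule SUP_least) (use le J_le_value_fun[OF _ s] in \<open>auto intro: order_trans\<close>)
  show "ereal (J M s (randomize (u n))) \<le> J_opt M s"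
    by (rule J_le_J_opt[OF HD]) simp
qed

lemma run_converges:
  assumes run: "\<And>n. alg_run M Y s u w n"
  shows "(\<lambda>k. ereal (J M s (randomize (u k)))) \<longlonglongrightarrow> J_opt M s"
proof -
  let ?J = "\<lambda>k. J M s (randomize (u k))" and ?y = "\<lambda>k. pseudo_mean M s (u k)"
    and ?l = "risk_aversion M"
  have HD: "u k \<in> policies_HD M" for k by (rule alg_run_policies_HD[OF run order_refl])
  have step: "inner_optimal M (w k)" "u (Suc k) = generated (w k) (?y k)" for k
    using alg_step_generated[of M Y s u w k] run[of "Suc k"] by (auto simp: alg_run_def)
  have mono: "?J k \<le> ?J (Suc k)" for k
    unfolding step(2) by (rule J_mono_step[OF HD step(1)])
  have descent: "value_fun M 0 s z \<le> ?J (Suc k) + ?l * ((z - ?y k)\<^sup>2 - (z - ?y (Suc k))\<^sup>2)" for z k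
    using value_fun_le_J_generated[OF step(1)[of k], of z "?y k"]
    unfolding step(2)[of k, symmetric] by (simp add: pseudo_mean_def)
  \<comment> \<open>Sum of the descent inequalities. By monotonicity every intermediate
    \<open>?J\<close> may be replaced by the last one.\<close>
  have telescope: "real n * (value_fun M 0 s z - ?J n) \<le> ?l * ((z - ?y 0)\<^sup>2 - (z - ?y n)\<^sup>2)" for n z
  proof (induction n)
    case (Suc n)
    have "real n * (value_fun M 0 s z - ?J (Suc n)) \<le> real n * (value_fun M 0 s z - ?J n)"
      using mono[of n] by (intro mult_left_mono) auto
    with Suc descent[of z n] show ?case by (simp add: algebra_simps)
  qed simp
  have "incseq (\<lambda>k. ereal (?J k))"
    using mono by (intro incseq_SucI) simp
  moreover have "(SUP k. ereal (?J k)) = J_opt M s"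
  proof (rule antisym)
    show "(SUP k. ereal (?J k)) \<le> J_opt M s"
      by (rule SUP_least) (rule J_le_J_opt[OF HD])
    show "J_opt M s \<le> (SUP k. ereal (?J k))"
      unfolding J_opt_def
    proof (rule SUP_least, rule ereal_le_epsilon2)
      fix v :: rand_policy and e :: real
      assume v: "v \<in> policies_HR M" and e: "0 < e"
      \<comment> \<open>The reference point \<open>z\<close> is the mean of the competitor
        \<open>v\<close>, where the value function dominates \<open>J M s v\<close>. Then
        \<open>?c / n\<close> bounds the gap after \<open>n\<close> steps, and \<open>n\<close> is
        taken large enough to bring it below \<open>e\<close>.\<close>
      let ?c = "?l * (mean M s v - ?y 0)\<^sup>2"
      obtain n where n: "?c < real n * e" using reals_Archimedean3[OF e] by blast
      have l: "0 \<le> ?l" using mdp by (simp add: mv_mdp_def)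
      \<comment> \<open>Since \<open>?c\<close> is nonnegative, \<open>n = 0\<close> would
        contradict the choice of \<open>n\<close>; the factor \<open>real n\<close> can thus be
        cancelled.\<close>
      have "n \<noteq> 0" using n l by (intro notI) (simp add: mult_less_0_iff)
      have "real n * (J M s v - ?J n) \<le> real n * (value_fun M 0 s (mean M s v) - ?J n)"
        using J_le_value_fun[OF v s] by (intro mult_left_mono) auto
      also have "\<dots> \<le> ?c"
        using telescope[of n "mean M s v"] l by (smt (verit) mult_left_mono zero_le_power2)
      finally have "real n * (J M s v - ?J n) < real n * e" using n by linarith
      then have "J M s v \<le> ?J n + e" using \<open>n \<noteq> 0\<close> by simp
      then have "ereal (J M s v) \<le> ereal (?J n) + ereal e" by simp
      also have "\<dots> \<le> (SUP k. ereal (?J k)) + ereal e"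
        by (intro add_right_mono SUP_upper) simp
      finally show "ereal (J M s v) \<le> (SUP k. ereal (?J k)) + ereal e" .
    qed
  qed
  ultimately show ?thesis using LIMSEQ_SUP by metis
qed

end

end

theorem theorem7:
  fixes M :: "'x mv_mdp" and Y :: "real set" and s0 :: real
    and f1 f2 f3 r1 r2 r3 :: "nat \<Rightarrow> 'x \<Rightarrow> real"
  assumes mdp: "mv_mdp M"
    and finite_exp: "finite_expectations M"
    and selection: "\<exists>w. inner_optimal M w"
    and s0: "s0 \<in> states M"
    and Y: "is_interval Y" "\<And>u. u \<in> policies_HR M \<Longrightarrow> mean M s0 u \<in> Y"
    and convexity: "convex (states M)" "convex (actions M)" "compact (actions M)"
      "convex (state_actions M)"
    and linear_f: "\<And>t s a x. t < horizon M \<Longrightarrow> (s, a) \<in> state_actions M \<Longrightarrow>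
      x \<in> space (noise_space M) \<Longrightarrow> transition M t s a x = f1 t x * s + f2 t x * a + f3 t x"
    and linear_r: "\<And>t s a x. t < horizon M \<Longrightarrow> (s, a) \<in> state_actions M \<Longrightarrow>
      x \<in> space (noise_space M) \<Longrightarrow> reward M t s a x = r1 t x * s + r2 t x * a + r3 t x"
  shows "(\<forall>u w. (\<forall>n. alg_run M Y s0 u w n) \<longrightarrow>
            (\<lambda>k. ereal (J M s0 (randomize (u k)))) \<longlonglongrightarrow> J_opt M s0) \<and>
         (\<forall>u w n. alg_stops M Y s0 u w n \<longrightarrow>
            ereal (J M s0 (randomize (u n))) = J_opt M s0)"
proof -
  interpret solvable_mdp M
    by unfold_locales (fact mdp finite_exp selection)+
  have joint: "concave_on (states M \<times> UNIV) (\<lambda>(s, y). value_fun M 0 s y)"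
    by (rule value_fun_concave[OF convexity(1,4) linear_f linear_r]) auto
  \<comment> \<open>Joint concavity restricted to the line with state \<open>s0\<close> fixed, on
    which the target ranges over all reals.\<close>
  have "concave_on UNIV (value_fun M 0 s0)"
    unfolding concave_on_iff
  proof (intro conjI ballI allI impI)
    fix y y' p q :: real
    assume pq: "0 \<le> p" "0 \<le> q" "p + q = 1"
    then have "p * s0 + q * s0 = s0" by (simp flip: distrib_right)
    then show "p * value_fun M 0 s0 y + q * value_fun M 0 s0 y' \<le> value_fun M 0 s0 (p *\<^sub>R y + q *\<^sub>R y')"
      using joint s0 pq unfolding concave_on_iff by fastforce
  qed simp
  then show ?thesis
    using run_converges[OF s0] stopped_optimal[OF s0] by blast
qed

end
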